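(* Let $T>0$, let $D\subset\mathbb{R}^d$ be a bounded domain with Lipschitz boundary, let $H\in(0,1)$, and let $f,g\in L^2(D)$ be deterministic functions with compact supports contained in $D$ and $\|g\|_{L^2(D)}\neq0$. Let $h\in L^\infty(0,T)$ be a deterministic nonnegative function whose support has positive measure. Then the inverse problem of recovering $f$ from $\{\mathbb{E}(u_k(T))\}_{k\ge1}$ and $\pm g$ from the covariances of $\{u_k(T)\}_{k\ge1}$ is unstable, in the sense that in the identities $$\mathbb{E}(u_k(T))=f_k\int_0^Th(\tau)\frac{\sin(\sqrt{\lambda_k}(T-\tau))}{\sqrt{\lambda_k}}\,d\tau,\qquad \mathrm{Cov}(u_k(T),u_k(T))=g_k^2\,\mathbb{E}\left[\left(\int_0^T\frac{\sin(\sqrt{\lambda_k}(T-\tau))}{\sqrt{\lambda_k}}\,dB^H(\tau)\right)^2\right]$$ the factors multiplying $f_k$ and $g_k^2$ tend to $0$ as $k\to\infty$. Moreover, there is a constant $C>0$ independent of $k$ such that for all $k\ge1$ $$\left|\int_0^Th(\tau)\frac{\sin(\sqrt{\lambda_k}(T-\tau))}{\sqrt{\lambda_k}}\,d\tau\right|\le \frac{C}{\sqrt{\lambda_k}}$$ and $$\mathbb{E}\left[\left(\int_0^T\frac{\sin(\sqrt{\lambda_k}(T-\tau))}{\sqrt{\lambda_k}}\,dB^H(\tau)\right)^2\right]\le C\lambda_k^{-\gamma},\qquad \gamma=\min\{2H,1\}.$$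
   Context: $B^H$ is a one-dimensional fractional Brownian motion with Hurst index $H\in(0,1)$: the centered Gaussian process with $B^H(0)=0$ and covariance $\mathbb{E}[B^H(t)B^H(s)]=\frac12(t^{2H}+s^{2H}-|t-s|^{2H})$, $s,t\ge0$. Integrals $\int_0^T\psi\,dB^H$ of deterministic $\psi$ are Wiener integrals with respect to $B^H$, i.e. the isometric extension to the closure $\mathcal H$ of the step functions under the inner product $\langle\chi_{[0,t]},\chi_{[0,s]}\rangle_{\mathcal H}=\mathbb{E}[B^H(t)B^H(s)]$ of the map $\chi_{[0,t]}\mapsto B^H(t)$. $\{\lambda_k,\varphi_k\}_{k\ge1}$ is the eigensystem of $-\Delta$ on $D$ with homogeneous Dirichlet boundary condition: $0<\lambda_1\le\lambda_2\le\cdots$, $\lambda_k\to\infty$, and $\{\varphi_k\}$ is an orthonormal basis of $L^2(D)$. For $v\in L^2(D)$, $v_k=(v,\varphi_k)_{L^2(D)}$; thus $f_k=(f,\varphi_k)_{L^2(D)}$ and $g_k=(g,\varphi_k)_{L^2(D)}$. $\mathrm{Cov}(X,Y)=\mathbb{E}[(X-\mathbb{E}X)(Y-\mathbb{E}Y)]$. The data are $u_k(T)=(u(\cdot,T),\varphi_k)_{L^2(D)}$, where $u$ is the mild solution of $u_{tt}-\Delta u=f(x)h(t)+g(x)\dot B^H(t)$ in $D\times(0,T)$, $u=0$ on $\partial D\times[0,T]$, $u(x,0)=u_t(x,0)=0$ for $x\in\overline D$; explicitly $$u_k(T)=f_k\int_0^T\frac{\sin((T-\tau)\sqrt{\lambda_k})}{\sqrt{\lambda_k}}h(\tau)\,d\tau+g_k\int_0^T\frac{\sin((T-\tau)\sqrt{\lambda_k})}{\sqrt{\lambda_k}}\,dB^H(\tau).$$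 *)

theory Defs
  imports "HOL-Probability.Probability"
begin

subsection \<open>Lebesgue spaces\<close>

definition L2 :: "'x measure \<Rightarrow> ('x \<Rightarrow> 'b::euclidean_space) set" where
  "L2 M = {f \<in> borel_measurable M. integrable M (\<lambda>x. f x \<bullet> f x)}"

definition l2_inner :: "'x measure \<Rightarrow> ('x \<Rightarrow> 'b::euclidean_space) \<Rightarrow> ('x \<Rightarrow> 'b) \<Rightarrow> real" where
  "l2_inner M f g = (\<integral>x. f x \<bullet> g x \<partial>M)"

definition l2_norm :: "'x measure \<Rightarrow> ('x \<Rightarrow> 'b::euclidean_space) \<Rightarrow> real" where
  "l2_norm M f = sqrt (l2_inner M f f)"

definition l2_tendsto ::
  "'x measure \<Rightarrow> (nat \<Rightarrow> 'x \<Rightarrow> 'b::euclidean_space) \<Rightarrow> ('x \<Rightarrow> 'b) \<Rightarrow> bool" where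
  "l2_tendsto M fs f \<longleftrightarrow> (\<lambda>n. l2_norm M (\<lambda>x. fs n x - f x)) \<longlonglongrightarrow> 0"

definition Linfty :: "'x measure \<Rightarrow> ('x \<Rightarrow> real) set" where
  "Linfty M = {f \<in> borel_measurable M. \<exists>K. AE x in M. \<bar>f x\<bar> \<le> K}"

text \<open>
  Support of an almost-everywhere class of functions on \<open>U\<close>: the complement of the largest open
  set on which the function vanishes almost everywhere. It is a closed set, so it is a compact
  subset of \<open>U\<close> iff the class has compact support in \<open>U\<close>.
\<close>
definition ess_support :: "'a::euclidean_space set \<Rightarrow> ('a \<Rightarrow> real) \<Rightarrow> 'a set" where
  "ess_support U f = {x. \<forall>r>0. \<not> (AE y in lebesgue_on U. y \<in> ball x r \<longrightarrow> f y = 0)}"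

subsection \<open>Domains and the Dirichlet Laplacian\<close>

text \<open>
  Near each boundary point, in suitable orthonormal coordinates whose last axis is \<open>e\<close>, the set
  is the part of a ball strictly above the graph of a Lipschitz function \<open>\<gamma>\<close> of the other
  coordinates.
\<close>
definition lipschitz_boundary :: "'a::euclidean_space set \<Rightarrow> bool" where
  "lipschitz_boundary D \<longleftrightarrow>
     (\<forall>p\<in>frontier D. \<exists>r>0. \<exists>e L. \<exists>\<gamma>::'a \<Rightarrow> real.
        norm e = 1 \<and> L-lipschitz_on {y. y \<bullet> e = 0} \<gamma> \<and>
        D \<inter> ball p r = {x \<in> ball p r. \<gamma> (x - (x \<bullet> e) *\<^sub>R e) < x \<bullet> e})"

definition bounded_lipschitz_domain :: "'a::euclidean_space set \<Rightarrow> bool" where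
  "bounded_lipschitz_domain D \<longleftrightarrow>
     open D \<and> connected D \<and> D \<noteq> {} \<and> bounded D \<and> lipschitz_boundary D"

primrec C_k :: "nat \<Rightarrow> ('a::euclidean_space \<Rightarrow> real) \<Rightarrow> bool" where
  "C_k 0 f \<longleftrightarrow> continuous_on UNIV f"
| "C_k (Suc n) f \<longleftrightarrow>
     f differentiable_on UNIV \<and> (\<forall>b\<in>Basis. C_k n (\<lambda>x. frechet_derivative f (at x) b))"

definition gradient :: "('a::euclidean_space \<Rightarrow> real) \<Rightarrow> 'a \<Rightarrow> 'a" where
  "gradient f x = (\<Sum>b\<in>Basis. frechet_derivative f (at x) b *\<^sub>R b)"

definition test_function :: "'a::euclidean_space set \<Rightarrow> ('a \<Rightarrow> real) \<Rightarrow> bool" where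
  "test_function D \<psi> \<longleftrightarrow>
     (\<forall>n. C_k n \<psi>) \<and> compact (closure {x. \<psi> x \<noteq> 0}) \<and> closure {x. \<psi> x \<noteq> 0} \<subseteq> D"

text \<open>
  \<open>H10 D v V\<close>: the function \<open>v\<close> lies in the Sobolev space $H^1_0(D)$, the closure of the test
  functions in $H^1(D)$, and \<open>V\<close> is its weak gradient.
\<close>
definition H10 :: "'a::euclidean_space set \<Rightarrow> ('a \<Rightarrow> real) \<Rightarrow> ('a \<Rightarrow> 'a) \<Rightarrow> bool" where
  "H10 D v V \<longleftrightarrow> v \<in> L2 (lebesgue_on D) \<and> V \<in> L2 (lebesgue_on D) \<and>
     (\<exists>\<psi>. (\<forall>n. test_function D (\<psi> n)) \<and>
          l2_tendsto (lebesgue_on D) \<psi> v \<and>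
          l2_tendsto (lebesgue_on D) (\<lambda>n. gradient (\<psi> n)) V)"

text \<open>The weak form of \<open>-\<Delta>\<phi> = \<mu> \<phi>\<close> in \<open>D\<close>, \<open>\<phi> = 0\<close> on the boundary.\<close>
definition dirichlet_eigenpair ::
  "'a::euclidean_space set \<Rightarrow> real \<Rightarrow> ('a \<Rightarrow> real) \<Rightarrow> bool" where
  "dirichlet_eigenpair D \<mu> \<phi> \<longleftrightarrow>
     (\<exists>G. H10 D \<phi> G \<and>
       (\<forall>v V. H10 D v V \<longrightarrow>
          l2_inner (lebesgue_on D) G V = \<mu> * l2_inner (lebesgue_on D) \<phi> v))"

definition orthonormal_basis_L2 :: "'x measure \<Rightarrow> (nat \<Rightarrow> 'x \<Rightarrow> real) \<Rightarrow> bool" where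
  "orthonormal_basis_L2 M \<phi> \<longleftrightarrow>
     (\<forall>k\<ge>1. \<phi> k \<in> L2 M) \<and>
     (\<forall>j\<ge>1. \<forall>k\<ge>1. l2_inner M (\<phi> j) (\<phi> k) = (if j = k then 1 else 0)) \<and>
     (\<forall>v\<in>L2 M. l2_tendsto M (\<lambda>n x. \<Sum>k=1..n. l2_inner M v (\<phi> k) * \<phi> k x) v)"

text \<open>Indices start at 1; the values of \<open>lam\<close> and \<open>\<phi>\<close> at 0 are irrelevant.\<close>
definition dirichlet_eigensystem ::
  "'a::euclidean_space set \<Rightarrow> (nat \<Rightarrow> real) \<Rightarrow> (nat \<Rightarrow> 'a \<Rightarrow> real) \<Rightarrow> bool" where
  "dirichlet_eigensystem D lam \<phi> \<longleftrightarrow>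
     0 < lam 1 \<and> (\<forall>j\<ge>1. \<forall>k\<ge>j. lam j \<le> lam k) \<and> filterlim lam at_top sequentially \<and>
     (\<forall>k\<ge>1. dirichlet_eigenpair D (lam k) (\<phi> k)) \<and>
     orthonormal_basis_L2 (lebesgue_on D) \<phi>"

subsection \<open>Fractional Brownian motion and Wiener integrals\<close>

definition covariance :: "'w measure \<Rightarrow> ('w \<Rightarrow> real) \<Rightarrow> ('w \<Rightarrow> real) \<Rightarrow> real" where
  "covariance M X Y =
     (\<integral>\<omega>. (X \<omega> - (\<integral>\<eta>. X \<eta> \<partial>M)) * (Y \<omega> - (\<integral>\<eta>. Y \<eta> \<partial>M)) \<partial>M)"

text \<open>Almost surely constant random variables count as (degenerate) Gaussian.\<close>
definition gaussian_rv :: "'w measure \<Rightarrow> ('w \<Rightarrow> real) \<Rightarrow> bool" where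
  "gaussian_rv M X \<longleftrightarrow> X \<in> borel_measurable M \<and>
     (\<exists>m. (AE \<omega> in M. X \<omega> = m) \<or>
          (\<exists>\<sigma>>0. distributed M lborel X (\<lambda>x. ennreal (normal_density m \<sigma> x))))"

definition gaussian_process :: "'w measure \<Rightarrow> 't set \<Rightarrow> ('t \<Rightarrow> 'w \<Rightarrow> real) \<Rightarrow> bool" where
  "gaussian_process M I X \<longleftrightarrow>
     (\<forall>J c. finite J \<and> J \<subseteq> I \<longrightarrow> gaussian_rv M (\<lambda>\<omega>. \<Sum>t\<in>J. c t * X t \<omega>))"

definition fractional_brownian_motion ::
  "'w measure \<Rightarrow> real \<Rightarrow> (real \<Rightarrow> 'w \<Rightarrow> real) \<Rightarrow> bool" where
  "fractional_brownian_motion M H B \<longleftrightarrow>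
     gaussian_process M {0..} B \<and>
     (AE \<omega> in M. B 0 \<omega> = 0) \<and>
     (\<forall>t\<ge>0. (\<integral>\<omega>. B t \<omega> \<partial>M) = 0) \<and>
     (\<forall>t\<ge>0. \<forall>s\<ge>0. (\<integral>\<omega>. B t \<omega> * B s \<omega> \<partial>M) =
        (t powr (2 * H) + s powr (2 * H) - \<bar>t - s\<bar> powr (2 * H)) / 2)"

text \<open>
  A step function on \<open>[0,T]\<close> is a linear combination of indicators of intervals \<open>[0,t]\<close>, and
  \<open>step_integral\<close> is the linear extension of the map sending the indicator of \<open>[0,t]\<close> to \<open>B t\<close>.
\<close>
definition step_function :: "real set \<Rightarrow> (real \<Rightarrow> real) \<Rightarrow> real \<Rightarrow> real" where
  "step_function J c \<tau> = (\<Sum>t\<in>J. c t * indicator {0..t} \<tau>)"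

definition step_integral ::
  "(real \<Rightarrow> 'w \<Rightarrow> real) \<Rightarrow> real set \<Rightarrow> (real \<Rightarrow> real) \<Rightarrow> 'w \<Rightarrow> real" where
  "step_integral B J c \<omega> = (\<Sum>t\<in>J. c t * B t \<omega>)"

text \<open>
  \<open>X\<close> is (a version of) the Wiener integral of \<open>\<psi>\<close> over \<open>[0,T]\<close>. The inner product of two step
  functions in the reproducing space is by definition the \<open>L2 M\<close> inner product of their
  integrals, so a sequence of step functions is Cauchy in that space exactly when its integrals
  are Cauchy in \<open>L2 M\<close>, and \<open>X\<close> is the image of the limit. A function \<open>\<psi>\<close> is identified with
  the element of the completion represented by such a sequence if the sequence also converges
  to \<open>\<psi>\<close> in $L^2(0,T)$. That element does not depend on the sequence: up to a
  constant, the norm of the reproducing space is bounded by the $L^2(0,T)$ norm if \<open>H \<ge> 1/2\<close>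
  and bounds the $L^2(0,T)$ norm if \<open>H < 1/2\<close>. No function outside $L^2(0,T)$ is integrated here.
\<close>
definition is_wiener_integral ::
  "'w measure \<Rightarrow> (real \<Rightarrow> 'w \<Rightarrow> real) \<Rightarrow> real \<Rightarrow> (real \<Rightarrow> real) \<Rightarrow> ('w \<Rightarrow> real) \<Rightarrow> bool" where
  "is_wiener_integral M B T \<psi> X \<longleftrightarrow>
     \<psi> \<in> L2 (lebesgue_on {0..T}) \<and> X \<in> L2 M \<and>
     (\<exists>J c. (\<forall>n. finite (J n) \<and> J n \<subseteq> {0..T}) \<and>
        l2_tendsto (lebesgue_on {0..T}) (\<lambda>n. step_function (J n) (c n)) \<psi> \<and>
        l2_tendsto M (\<lambda>n. step_integral B (J n) (c n)) X)"

definition wiener_integral ::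
  "'w measure \<Rightarrow> (real \<Rightarrow> 'w \<Rightarrow> real) \<Rightarrow> real \<Rightarrow> (real \<Rightarrow> real) \<Rightarrow> 'w \<Rightarrow> real" where
  "wiener_integral M B T \<psi> = (SOME X. is_wiener_integral M B T \<psi> X)"

subsection \<open>The stochastic wave equation\<close>

text \<open>
  With \<open>A\<close> the Dirichlet Laplacian \<open>-\<Delta>\<close> and \<open>S(t) = sin(t A^(1/2)) A^(-1/2)\<close>, this is the inner
  product \<open>(S(t) w, v)\<close> in $L^2(D)$, expanded in the eigenfunctions.
\<close>
definition wave_propagator_inner ::
  "'a::euclidean_space set \<Rightarrow> (nat \<Rightarrow> real) \<Rightarrow> (nat \<Rightarrow> 'a \<Rightarrow> real) \<Rightarrow>
   real \<Rightarrow> ('a \<Rightarrow> real) \<Rightarrow> ('a \<Rightarrow> real) \<Rightarrow> real" where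
  "wave_propagator_inner D lam \<phi> t w v =
     (\<Sum>\<^sub>\<infinity>k\<in>{1..}. sin (sqrt (lam k) * t) / sqrt (lam k) *
        l2_inner (lebesgue_on D) w (\<phi> k) * l2_inner (lebesgue_on D) v (\<phi> k))"

text \<open>
  Mild solution of \<open>u_tt - \<Delta>u = f(x) h(t) + g(x) dB/dt\<close> on \<open>D \<times> (0,T)\<close> with zero boundary and
  initial values: \<open>u(t)\<close> is an $L^2(D)$-valued random variable with
  \<open>u(t) = \<integral>_0^t S(t-\<tau>) f h(\<tau>) d\<tau> + \<integral>_0^t S(t-\<tau>) g dB(\<tau>)\<close>. Measurability and the identity
  between vectors of the separable space $L^2(D)$ are expressed by testing against all \<open>v\<close>.
\<close>
definition mild_solution ::
  "'a::euclidean_space set \<Rightarrow> (nat \<Rightarrow> real) \<Rightarrow> (nat \<Rightarrow> 'a \<Rightarrow> real) \<Rightarrow>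
   'w measure \<Rightarrow> (real \<Rightarrow> 'w \<Rightarrow> real) \<Rightarrow> real \<Rightarrow>
   ('a \<Rightarrow> real) \<Rightarrow> ('a \<Rightarrow> real) \<Rightarrow> (real \<Rightarrow> real) \<Rightarrow> (real \<Rightarrow> 'w \<Rightarrow> 'a \<Rightarrow> real) \<Rightarrow> bool" where
  "mild_solution D lam \<phi> M B T f g h u \<longleftrightarrow>
     (\<forall>t\<in>{0..T}.
        (\<forall>\<omega>\<in>space M. u t \<omega> \<in> L2 (lebesgue_on D)) \<and>
        (\<forall>v\<in>L2 (lebesgue_on D).
           (\<lambda>\<omega>. l2_inner (lebesgue_on D) (u t \<omega>) v) \<in> borel_measurable M \<and>
           (AE \<omega> in M. l2_inner (lebesgue_on D) (u t \<omega>) v =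
              (\<integral>\<tau>. wave_propagator_inner D lam \<phi> (t - \<tau>) f v * h \<tau> \<partial>lebesgue_on {0<..<t}) +
              wiener_integral M B t (\<lambda>\<tau>. wave_propagator_inner D lam \<phi> (t - \<tau>) g v) \<omega>)))"

end

theory Submission
  imports Defs
begin

text \<open>
  The identities for mean and variance hold because, tested against \<open>\<phi> k\<close>, the wave propagator
  reduces to the single mode \<open>\<psi>(\<tau>) = sin (\<surd>\<lambda> (T - \<tau>)) / \<surd>\<lambda>\<close>, and because the Wiener
  integral is centered, linear and almost surely unique. Uniqueness, which for \<open>H < 1/2\<close> does not
  follow from a norm comparison, comes from testing an integral \<open>X\<close> against increments of \<open>B\<close>:
  the average of \<open>E[X (B (t + d) - B t)]\<close> over \<open>t\<close> is a continuous functional of \<open>\<psi>\<close> in $L^2(0,T)$.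
  Existence for Lipschitz \<open>\<psi>\<close> comes from dyadic Riemann sums, whose successive distances are
  of order \<open>2^(-n H)\<close>.

  For the second moment, write a Riemann sum as \<open>\<Sum> a_i \<Delta>_i\<close> with \<open>c_ij = E[\<Delta>_i \<Delta>_j]\<close>. Then
  \<open>\<Sum> a_i a_j c_ij = \<Sum>_i a_i^2 (\<Sum>_j c_ij) - 1/2 \<Sum> (a_i - a_j)^2 c_ij\<close>. The first sum is at most
  \<open>sup \<psi>^2 T^(2H)\<close>, since all \<open>\<Sum>_j c_ij = E[\<Delta>_i B T]\<close> are nonnegative. The double sum is
  nonnegative for \<open>H \<ge> 1/2\<close> and can be dropped. For \<open>H < 1/2\<close> and \<open>i \<noteq> j\<close> one has
  \<open>- c_ij \<le> |t_i - t_j|^(2H-2) dt^2\<close>, and interpolating \<open>|a_i - a_j|\<close> between \<open>2 / \<surd>\<lambda>\<close> and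
  \<open>|t_i - t_j|\<close> leaves the factor \<open>\<lambda>^(-2H)\<close> times the integrable kernel \<open>|t_i - t_j|^(-2H)\<close>.
\<close>

section \<open>Real-valued square integrable functions\<close>

lemma L2_real_iff:
  fixes f :: "'x \<Rightarrow> real"
  shows "f \<in> L2 M \<longleftrightarrow> f \<in> borel_measurable M \<and> integrable M (\<lambda>x. (f x)\<^sup>2)"
  by (simp add: L2_def power2_eq_square)

lemma L2_measurable [measurable_dest]:
  "f \<in> L2 M \<Longrightarrow> f \<in> borel_measurable M"
  by (simp add: L2_def)

lemma l2_inner_real: "l2_inner M f g = (\<integral>x. f x * g x \<partial>M)" for f g :: "'x \<Rightarrow> real"
  by (simp add: l2_inner_def)

lemma l2_inner_commute: "l2_inner M f g = l2_inner M g f"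
  by (simp add: l2_inner_def inner_commute)

lemma l2_inner_self_nonneg: "0 \<le> l2_inner M f f"
  by (simp add: l2_inner_def)

lemma l2_norm_nonneg [simp]: "0 \<le> l2_norm M f"
  by (simp add: l2_norm_def l2_inner_self_nonneg)

lemma l2_norm_sq: "(l2_norm M f)\<^sup>2 = l2_inner M f f"
  by (simp add: l2_norm_def l2_inner_self_nonneg)

lemma L2_mult_integrable:
  fixes f g :: "'x \<Rightarrow> real"
  assumes "f \<in> L2 M" "g \<in> L2 M"
  shows "integrable M (\<lambda>x. f x * g x)"
proof (rule Bochner_Integration.integrable_bound[of M "\<lambda>x. (f x)\<^sup>2 + (g x)\<^sup>2"])
  show "integrable M (\<lambda>x. (f x)\<^sup>2 + (g x)\<^sup>2)"
    using assms by (simp add: L2_real_iff)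
  show "(\<lambda>x. f x * g x) \<in> borel_measurable M"
    using assms by (auto simp: L2_real_iff)
  have "\<bar>a * b\<bar> \<le> a\<^sup>2 + b\<^sup>2" for a b :: real
    using sum_squares_bound[of a b] sum_squares_bound[of "- a" b] zero_le_power2[of a] zero_le_power2[of b] by (auto simp: abs_if)
  then show "AE x in M. norm (f x * g x) \<le> norm ((f x)\<^sup>2 + (g x)\<^sup>2)"
    by (intro AE_I2) (simp add: abs_of_nonneg)
qed

lemma L2_add [intro]:
  fixes f g :: "'x \<Rightarrow> real"
  assumes "f \<in> L2 M" "g \<in> L2 M"
  shows "(\<lambda>x. f x + g x) \<in> L2 M"
  using assms L2_mult_integrable[OF assms] by (auto simp: L2_real_iff power2_sum mult.assoc)

lemma L2_cmult [intro]:
  fixes f :: "'x \<Rightarrow> real"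
  assumes "f \<in> L2 M"
  shows "(\<lambda>x. c * f x) \<in> L2 M"
  using assms by (auto simp: L2_real_iff power_mult_distrib)

lemma L2_diff [intro]:
  fixes f g :: "'x \<Rightarrow> real"
  assumes "f \<in> L2 M" "g \<in> L2 M"
  shows "(\<lambda>x. f x - g x) \<in> L2 M"
  using L2_add[OF assms(1) L2_cmult[OF assms(2), of "-1"]] by simp

lemma L2_zero [simp]: "(\<lambda>x. 0::real) \<in> L2 M"
  by (simp add: L2_def)

lemma L2_sum [intro]:
  fixes f :: "'i \<Rightarrow> 'x \<Rightarrow> real"
  assumes "\<And>i. i \<in> I \<Longrightarrow> f i \<in> L2 M"
  shows "(\<lambda>x. \<Sum>i\<in>I. f i x) \<in> L2 M"
  using assms by (induction I rule: infinite_finite_induct) auto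

lemma L2_bounded:
  fixes f :: "'x \<Rightarrow> real"
  assumes "finite_measure M" "f \<in> borel_measurable M" "AE x in M. \<bar>f x\<bar> \<le> K"
  shows "f \<in> L2 M"
proof -
  interpret finite_measure M by fact
  have "AE x in M. norm ((f x)\<^sup>2) \<le> K\<^sup>2"
    using assms(3) by eventually_elim (metis abs_ge_zero norm_power power_mono real_norm_def)
  then have "integrable M (\<lambda>x. (f x)\<^sup>2)"
    using assms(2) by (intro integrable_const_bound[where B = "K\<^sup>2"]) auto
  with assms(2) show ?thesis
    by (simp add: L2_real_iff)
qed

lemma l2_inner_add_left:
  fixes f g k :: "'x \<Rightarrow> real"
  assumes "f \<in> L2 M" "g \<in> L2 M" "k \<in> L2 M"
  shows "l2_inner M (\<lambda>x. f x + g x) k = l2_inner M f k + l2_inner M g k"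
  using assms by (simp add: l2_inner_real distrib_right L2_mult_integrable)

lemma l2_inner_diff_left:
  fixes f g k :: "'x \<Rightarrow> real"
  assumes "f \<in> L2 M" "g \<in> L2 M" "k \<in> L2 M"
  shows "l2_inner M (\<lambda>x. f x - g x) k = l2_inner M f k - l2_inner M g k"
  using assms by (simp add: l2_inner_real left_diff_distrib L2_mult_integrable)

lemma l2_inner_diff_right:
  fixes f g k :: "'x \<Rightarrow> real"
  assumes "f \<in> L2 M" "g \<in> L2 M" "k \<in> L2 M"
  shows "l2_inner M k (\<lambda>x. f x - g x) = l2_inner M k f - l2_inner M k g"
  using l2_inner_diff_left[OF assms] by (simp add: l2_inner_commute)

lemma l2_inner_cmult_left:
  fixes f g :: "'x \<Rightarrow> real"
  shows "l2_inner M (\<lambda>x. c * f x) g = c * l2_inner M f g"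
  by (simp add: l2_inner_real mult.assoc)

lemma l2_inner_sum_left:
  fixes f :: "'i \<Rightarrow> 'x \<Rightarrow> real"
  assumes "\<And>i. i \<in> I \<Longrightarrow> f i \<in> L2 M" "g \<in> L2 M"
  shows "l2_inner M (\<lambda>x. \<Sum>i\<in>I. f i x) g = (\<Sum>i\<in>I. l2_inner M (f i) g)"
  using assms by (simp add: l2_inner_real sum_distrib_right L2_mult_integrable)

lemma l2_norm_cmult:
  fixes f :: "'x \<Rightarrow> real"
  shows "l2_norm M (\<lambda>x. c * f x) = \<bar>c\<bar> * l2_norm M f"
proof -
  have "l2_inner M (\<lambda>x. c * f x) (\<lambda>x. c * f x) = c\<^sup>2 * l2_inner M f f"
    by (simp add: l2_inner_real power2_eq_square mult_ac)
  then show ?thesis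
    by (simp add: l2_norm_def real_sqrt_mult)
qed

text \<open>The squared norm of \<open>f - c * g\<close> is a nonnegative quadratic in
  \<open>c\<close>; evaluating it at one suitable \<open>c\<close> gives the bound.\<close>

lemma l2_Cauchy_Schwarz:
  fixes f g :: "'x \<Rightarrow> real"
  assumes f: "f \<in> L2 M" and g: "g \<in> L2 M"
  shows "\<bar>l2_inner M f g\<bar> \<le> l2_norm M f * l2_norm M g"
proof -
  let ?A = "l2_inner M f f" and ?B = "l2_inner M g g" and ?C = "l2_inner M f g"
  have q: "0 \<le> ?A - 2 * c * ?C + c\<^sup>2 * ?B" for c
  proof -
    have "l2_inner M (\<lambda>x. f x - c * g x) (\<lambda>x. f x - c * g x) =
        ?A - 2 * c * ?C + c\<^sup>2 * ?B"
      using f g by (simp add: l2_inner_diff_left l2_inner_diff_right L2_cmult L2_diff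
          l2_inner_cmult_left l2_inner_commute[of M _ "\<lambda>x. c * g x"] l2_inner_commute[of M g f]
          power2_eq_square algebra_simps)
    then show ?thesis
      using l2_inner_self_nonneg by metis
  qed
  have "?C\<^sup>2 \<le> ?A * ?B"
  proof (cases "?B = 0")
    case True
    have "?C = 0"
    proof (rule ccontr)
      assume "?C \<noteq> 0"
      \<comment> \<open>With \<open>?B = 0\<close> the quadratic is affine in \<open>c\<close>, and
        this choice of \<open>c\<close> gives it the value -1.\<close>
      then show False
        using q[of "(?A + 1) / (2 * ?C)"] True by (simp add: field_simps)
    qed
    then show ?thesis
      using True by simp
  next
    case False
    then have "?B > 0"
      using l2_inner_self_nonneg[of M g] by simp
    \<comment> \<open>The chosen \<open>c\<close> minimises the quadratic.\<close>
    then show ?thesis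
      using q[of "?C / ?B"] by (simp add: field_simps power2_eq_square)
  qed
  then show ?thesis
    using real_sqrt_le_mono[of "?C\<^sup>2" "?A * ?B"] by (simp add: l2_norm_def real_sqrt_mult)
qed

lemma l2_norm_triangle:
  fixes f g :: "'x \<Rightarrow> real"
  assumes f: "f \<in> L2 M" and g: "g \<in> L2 M"
  shows "l2_norm M (\<lambda>x. f x + g x) \<le> l2_norm M f + l2_norm M g"
proof (rule power2_le_imp_le)
  have "l2_inner M k (\<lambda>x. f x + g x) = l2_inner M k f + l2_inner M k g" if "k \<in> L2 M" for k
    using l2_inner_add_left[OF f g that] by (simp add: l2_inner_commute)
  then have "(l2_norm M (\<lambda>x. f x + g x))\<^sup>2 = (l2_norm M f)\<^sup>2 + 2 * l2_inner M f g + (l2_norm M g)\<^sup>2"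
    using f g by (simp add: l2_norm_sq l2_inner_add_left L2_add l2_inner_commute[of M g f])
  also have "\<dots> \<le> (l2_norm M f + l2_norm M g)\<^sup>2"
    using l2_Cauchy_Schwarz[OF f g] by (simp add: power2_sum)
  finally show "(l2_norm M (\<lambda>x. f x + g x))\<^sup>2 \<le> (l2_norm M f + l2_norm M g)\<^sup>2" .
qed simp

lemma l2_norm_minus_commute:
  "l2_norm M (\<lambda>x. f x - g x) = l2_norm M (\<lambda>x. g x - f x)" for f g :: "'x \<Rightarrow> real"
  using l2_norm_cmult[of M "-1" "\<lambda>x. f x - g x"] by simp

lemma l2_norm_zero [simp]: "l2_norm M (\<lambda>x. 0::real) = 0"
  by (simp add: l2_norm_def l2_inner_def)

lemma l2_norm_sum:
  fixes f :: "'i \<Rightarrow> 'x \<Rightarrow> real"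
  assumes "\<And>i. i \<in> I \<Longrightarrow> f i \<in> L2 M"
  shows "l2_norm M (\<lambda>x. \<Sum>i\<in>I. f i x) \<le> (\<Sum>i\<in>I. l2_norm M (f i))"
  using assms
proof (induction I rule: infinite_finite_induct)
  case (insert i I)
  then have "l2_norm M (\<lambda>x. f i x + (\<Sum>i\<in>I. f i x))
      \<le> l2_norm M (f i) + l2_norm M (\<lambda>x. \<Sum>i\<in>I. f i x)"
    by (intro l2_norm_triangle) auto
  with insert show ?case
    by fastforce
qed auto

lemma l2_norm_eq_0_iff:
  fixes f :: "'x \<Rightarrow> real"
  assumes "f \<in> L2 M"
  shows "l2_norm M f = 0 \<longleftrightarrow> (AE x in M. f x = 0)"
  using assms by (auto simp: l2_norm_def l2_inner_real L2_real_iff power2_eq_square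
      integral_nonneg_eq_0_iff_AE)

lemma l2_inner_tendsto:
  fixes f :: "'x \<Rightarrow> real"
  assumes fs: "\<And>n. fs n \<in> L2 M" and f: "f \<in> L2 M" and g: "g \<in> L2 M"
    and lim: "l2_tendsto M fs f"
  shows "(\<lambda>n. l2_inner M (fs n) g) \<longlonglongrightarrow> l2_inner M f g"
proof -
  have "(\<lambda>n. l2_inner M (fs n) g - l2_inner M f g) \<longlonglongrightarrow> 0"
  proof (rule Lim_null_comparison)
    show "\<forall>\<^sub>F n in sequentially. norm (l2_inner M (fs n) g - l2_inner M f g)
        \<le> l2_norm M (\<lambda>x. fs n x - f x) * l2_norm M g"
      using l2_Cauchy_Schwarz[OF L2_diff[OF fs f] g] by (simp add: l2_inner_diff_left fs f g)
    show "(\<lambda>n. l2_norm M (\<lambda>x. fs n x - f x) * l2_norm M g) \<longlonglongrightarrow> 0"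
      using tendsto_mult_right[OF lim[unfolded l2_tendsto_def], of "l2_norm M g"] by simp
  qed
  then show ?thesis
    by (simp add: LIM_zero_iff)
qed

lemma l2_norm_tendsto:
  fixes f :: "'x \<Rightarrow> real"
  assumes fs: "\<And>n. fs n \<in> L2 M" and f: "f \<in> L2 M" and lim: "l2_tendsto M fs f"
  shows "(\<lambda>n. l2_norm M (fs n)) \<longlonglongrightarrow> l2_norm M f"
proof -
  have "(\<lambda>n. l2_norm M (fs n) - l2_norm M f) \<longlonglongrightarrow> 0"
  proof (rule Lim_null_comparison)
    have "norm (l2_norm M (fs n) - l2_norm M f) \<le> l2_norm M (\<lambda>x. fs n x - f x)" for n
      using l2_norm_triangle[OF L2_diff[OF fs[of n] f] f]
        l2_norm_triangle[OF L2_diff[OF f fs[of n]] fs[of n]]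
      by (simp add: l2_norm_minus_commute[of M f])
    then show "\<forall>\<^sub>F n in sequentially. norm (l2_norm M (fs n) - l2_norm M f)
        \<le> l2_norm M (\<lambda>x. fs n x - f x)"
      by simp
    show "(\<lambda>n. l2_norm M (\<lambda>x. fs n x - f x)) \<longlonglongrightarrow> 0"
      using lim by (simp add: l2_tendsto_def)
  qed
  then show ?thesis
    by (simp add: LIM_zero_iff)
qed

lemma l2_norm_le_bound:
  fixes f :: "'x \<Rightarrow> real"
  assumes "finite_measure M" "f \<in> borel_measurable M" "AE x in M. \<bar>f x\<bar> \<le> K" "0 \<le> K"
  shows "l2_norm M f \<le> K * sqrt (measure M (space M))"
proof -
  interpret finite_measure M by fact
  have "l2_inner M f f \<le> (\<integral>x. K\<^sup>2 \<partial>M)"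
    unfolding l2_inner_real
  proof (rule integral_mono_AE)
    show "integrable M (\<lambda>x. f x * f x)"
      using L2_bounded[OF assms(1-3)] by (simp add: L2_def)
    show "AE x in M. f x * f x \<le> K\<^sup>2"
      using assms(3) by eventually_elim (metis abs_ge_zero power2_abs power2_eq_square power_mono)
  qed simp
  then have "l2_norm M f \<le> sqrt (K\<^sup>2 * measure M (space M))"
    unfolding l2_norm_def by (intro real_sqrt_le_mono) (simp add: mult.commute)
  then show ?thesis
    using assms(4) by (simp add: real_sqrt_mult)
qed

section \<open>Completeness of real L2 spaces\<close>

lemma nn_integral_square_eq:
  fixes f :: "'x \<Rightarrow> real"
  assumes "f \<in> L2 M"
  shows "(\<integral>\<^sup>+x. ennreal ((f x)\<^sup>2) \<partial>M) = ennreal ((l2_norm M f)\<^sup>2)"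
  using assms nn_integral_eq_integral[of M "\<lambda>x. (f x)\<^sup>2"]
  by (simp add: L2_real_iff l2_norm_sq l2_inner_real flip: power2_eq_square)

text \<open>The nonnegative integral is meaningful before integrability is known, and it is the form
  in which Fatou's lemma delivers a bound; membership in \<open>L2\<close> and the norm estimate are
  both read off from it.\<close>

lemma L2_nn_integral_le:
  fixes f :: "'x \<Rightarrow> real"
  assumes f: "f \<in> borel_measurable M" and le: "(\<integral>\<^sup>+x. ennreal ((f x)\<^sup>2) \<partial>M) \<le> ennreal (K\<^sup>2)"
    and K: "0 \<le> K"
  shows "f \<in> L2 M" "l2_norm M f \<le> K"
proof -
  have "(\<integral>\<^sup>+x. ennreal ((f x)\<^sup>2) \<partial>M) < \<infinity>"
    using le ennreal_less_top by (metis infinity_ennreal_def le_less_trans)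
  then show L2: "f \<in> L2 M"
    using f by (auto simp: L2_real_iff intro!: integrableI_bounded)
  have "(l2_norm M f)\<^sup>2 \<le> K\<^sup>2"
    using le by (simp add: nn_integral_square_eq[OF L2] ennreal_le_iff)
  then show "l2_norm M f \<le> K"
    using K by (rule power2_le_imp_le)
qed

text \<open>Riesz-Fischer for sequences with summable successive distances. The partial sums of
  \<open>\<bar>d i x\<bar>\<close> are bounded in L2, so by monotone convergence their limit is
  finite almost everywhere and the sequence converges pointwise. Fatou's lemma then bounds the
  distance from \<open>fs n\<close> to the limit by the tail of the series.\<close>

lemma L2_complete:
  fixes fs :: "nat \<Rightarrow> 'x \<Rightarrow> real"
  assumes fs: "\<And>n. fs n \<in> L2 M"
    and sm: "summable (\<lambda>n. l2_norm M (\<lambda>x. fs (Suc n) x - fs n x))"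
  obtains f where "f \<in> L2 M" "l2_tendsto M fs f"
proof -
  define d where "d = (\<lambda>n x. fs (Suc n) x - fs n x)"
  define S where "S = (\<lambda>n x. \<Sum>i<n. \<bar>d i x\<bar>)"
  define C where "C = (\<Sum>n. l2_norm M (d n))"
  have sm_d: "summable (\<lambda>n. l2_norm M (d n))"
    using sm by (simp add: d_def)
  have d: "d n \<in> L2 M" for n
    unfolding d_def using fs by auto
  have abs_d: "(\<lambda>x. \<bar>d n x\<bar>) \<in> L2 M" "l2_norm M (\<lambda>x. \<bar>d n x\<bar>) = l2_norm M (d n)" for n
    using d[of n] by (auto simp: L2_real_iff l2_norm_def l2_inner_real)
  have S_L2: "S n \<in> L2 M" for n
    unfolding S_def using abs_d by auto
  note [measurable] = fs[THEN L2_measurable] S_L2[THEN L2_measurable]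
  have S_norm: "l2_norm M (S n) \<le> C" for n
  proof -
    have "l2_norm M (S n) \<le> (\<Sum>i<n. l2_norm M (\<lambda>x. \<bar>d i x\<bar>))"
      unfolding S_def using abs_d(1) by (rule l2_norm_sum)
    also have "\<dots> \<le> C"
      unfolding abs_d C_def using sm_d by (rule sum_le_suminf) auto
    finally show ?thesis .
  qed
  have S_mono: "S m x \<le> S n x" if "m \<le> n" for m n x
    unfolding S_def using that by (intro sum_mono2) auto
  have S_nonneg: "0 \<le> S n x" for n x
    by (simp add: S_def sum_nonneg)
  have inc: "incseq (\<lambda>n x. ennreal ((S n x)\<^sup>2))"
    unfolding incseq_def le_fun_def using S_mono S_nonneg
    by (auto intro!: ennreal_leI power_mono)
  have "(\<integral>\<^sup>+x. (SUP n. ennreal ((S n x)\<^sup>2)) \<partial>M) = (SUP n. \<integral>\<^sup>+x. ennreal ((S n x)\<^sup>2) \<partial>M)"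
    by (rule nn_integral_monotone_convergence_SUP[OF inc]) measurable
  also have "\<dots> \<le> ennreal (C\<^sup>2)"
    using S_norm by (auto simp: nn_integral_square_eq[OF S_L2] intro!: SUP_least ennreal_leI power_mono)
  finally have "AE x in M. (SUP n. ennreal ((S n x)\<^sup>2)) \<noteq> \<infinity>"
    by (intro nn_integral_PInf_AE) (auto simp: top_unique)
  then have conv: "AE x in M. (\<lambda>n. fs n x) \<longlonglongrightarrow> lim (\<lambda>n. fs n x)"
  proof eventually_elim
    case (elim x)
    define K where "K = enn2real (SUP n. ennreal ((S n x)\<^sup>2))"
    have "S n x \<le> sqrt K" for n
    proof (rule real_le_rsqrt)
      have "ennreal ((S n x)\<^sup>2) \<le> (SUP n. ennreal ((S n x)\<^sup>2))"
        by (rule SUP_upper) simp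
      also have "\<dots> = ennreal K"
        using elim by (simp only: K_def ennreal_enn2real_if infinity_ennreal_def if_False)
      finally show "(S n x)\<^sup>2 \<le> K"
        by (simp add: ennreal_le_iff K_def)
    qed
    then have "summable (\<lambda>i. \<bar>d i x\<bar>)"
      by (intro summableI_nonneg_bounded[where x = "sqrt K"]) (auto simp: S_def)
    then have "summable (\<lambda>i. d i x)"
      by (rule summable_rabs_cancel)
    then have "(\<lambda>n. fs 0 x + (\<Sum>i<n. d i x)) \<longlonglongrightarrow> fs 0 x + (\<Sum>i. d i x)"
      by (intro tendsto_intros summable_LIMSEQ)
    moreover have "fs 0 x + (\<Sum>i<n. d i x) = fs n x" for n
      using sum_lessThan_telescope[of "\<lambda>i. fs i x" n] by (simp add: d_def)
    ultimately have "convergent (\<lambda>n. fs n x)"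
      by (auto simp: convergent_def)
    then show ?case
      by (simp add: convergent_LIMSEQ_iff)
  qed
  \<comment> \<open>Where the sequence diverges, \<open>lim\<close> is one fixed unspecified value;
    this concerns only a null set and keeps \<open>f\<close> measurable.\<close>
  define f where "f = (\<lambda>x. lim (\<lambda>n. fs n x))"
  have [measurable]: "f \<in> borel_measurable M"
    unfolding f_def by measurable
  define tail where "tail n = C - (\<Sum>i<n. l2_norm M (d i))" for n
  have tail_nonneg: "0 \<le> tail n" for n
    unfolding tail_def C_def using sum_le_suminf[OF sm_d, of "{..<n}"] by simp
  have step: "l2_norm M (\<lambda>x. fs (k + n) x - fs n x) \<le> tail n" for k n
  proof -
    have "fs (k + n) x - fs n x = (\<Sum>i=n..<k+n. d i x)" for x
      unfolding d_def using sum_Suc_diff'[of n "k + n" "\<lambda>i. fs i x"] by simp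
    then have "l2_norm M (\<lambda>x. fs (k + n) x - fs n x) \<le> (\<Sum>i=n..<k+n. l2_norm M (d i))"
      using d by (simp add: l2_norm_sum)
    also have "\<dots> = (\<Sum>i<k+n. l2_norm M (d i)) - (\<Sum>i<n. l2_norm M (d i))"
      using sum_diff_nat_ivl[of 0 n "k + n" "\<lambda>i. l2_norm M (d i)"] by (simp add: atLeast0LessThan)
    also have "\<dots> \<le> tail n"
      unfolding tail_def C_def using sum_le_suminf[OF sm_d, of "{..<k+n}"] by simp
    finally show ?thesis .
  qed
  have fatou: "(\<integral>\<^sup>+x. ennreal ((f x - fs n x)\<^sup>2) \<partial>M) \<le> ennreal ((tail n)\<^sup>2)" for n
  proof -
    have "(\<integral>\<^sup>+x. ennreal ((f x - fs n x)\<^sup>2) \<partial>M)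
        = (\<integral>\<^sup>+x. liminf (\<lambda>k. ennreal ((fs (k + n) x - fs n x)\<^sup>2)) \<partial>M)"
    proof (rule nn_integral_cong_AE)
      show "AE x in M. ennreal ((f x - fs n x)\<^sup>2) = liminf (\<lambda>k. ennreal ((fs (k + n) x - fs n x)\<^sup>2))"
        using conv
      proof eventually_elim
        case (elim x)
        then have "(\<lambda>k. fs (k + n) x) \<longlonglongrightarrow> f x"
          unfolding f_def by (rule LIMSEQ_ignore_initial_segment)
        then have "(\<lambda>k. ennreal ((fs (k + n) x - fs n x)\<^sup>2)) \<longlonglongrightarrow> ennreal ((f x - fs n x)\<^sup>2)"
          by (intro tendsto_intros)
        then show ?case
          by (metis lim_imp_Liminf trivial_limit_sequentially)
      qed
    qed
    also have "\<dots> \<le> liminf (\<lambda>k. \<integral>\<^sup>+x. ennreal ((fs (k + n) x - fs n x)\<^sup>2) \<partial>M)"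
      by (rule nn_integral_liminf) measurable
    also have "\<dots> \<le> liminf (\<lambda>k::nat. ennreal ((tail n)\<^sup>2))"
      using step by (intro Liminf_mono always_eventually)
        (auto simp: nn_integral_square_eq L2_diff fs intro!: ennreal_leI power_mono)
    finally show ?thesis
      by (simp add: Liminf_const)
  qed
  have dn: "(\<lambda>x. f x - fs n x) \<in> L2 M" "l2_norm M (\<lambda>x. f x - fs n x) \<le> tail n" for n
    using fatou tail_nonneg by (auto intro!: L2_nn_integral_le)
  have "(\<lambda>x. (f x - fs 0 x) + fs 0 x) \<in> L2 M"
    using dn fs by (intro L2_add) auto
  then have "f \<in> L2 M"
    by simp
  moreover have "l2_tendsto M fs f"
    unfolding l2_tendsto_def
  proof (rule Lim_null_comparison)
    show "\<forall>\<^sub>F n in sequentially. norm (l2_norm M (\<lambda>x. fs n x - f x)) \<le> tail n"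
      using dn(2) by (simp add: l2_norm_minus_commute[of M _ f])
    have "tail \<longlonglongrightarrow> C - C"
      unfolding tail_def C_def by (intro tendsto_intros summable_LIMSEQ sm_d)
    then show "tail \<longlonglongrightarrow> 0"
      by simp
  qed
  ultimately show ?thesis
    using that by blast
qed

section \<open>Inequalities for real powers\<close>

text \<open>Weighted arithmetic-geometric mean of \<open>y\<close> and 1; equivalently, a concave
  power lies below its tangent at 1. The case \<open>y = 0\<close> uses the convention
  \<open>0 powr q = 0\<close>, which includes \<open>q = 0\<close>.\<close>

lemma powr_le_tangent:
  fixes y q :: real
  assumes "0 \<le> y" "0 \<le> q" "q \<le> 1"
  shows "y powr q \<le> 1 - q + q * y"
proof (cases "y = 0")
  case False
  then show ?thesis
    using Youngs_inequality_0[of q "1 - q" y 1] assms by simp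
qed (use assms in auto)

text \<open>Bernoulli's inequality, from the concave case with exponent \<open>1 / p\<close> applied
  to \<open>y powr p\<close>.\<close>

lemma powr_ge_tangent:
  fixes y p :: real
  assumes "0 \<le> y" "1 \<le> p"
  shows "1 + p * (y - 1) \<le> y powr p"
proof -
  have "y \<le> 1 - 1 / p + y powr p / p"
    using powr_le_tangent[of "y powr p" "1 / p"] assms by (simp add: powr_powr)
  then have "p * y \<le> p * (1 - 1 / p + y powr p / p)"
    using assms by (intro mult_left_mono) auto
  then show ?thesis
    using assms by (simp add: algebra_simps)
qed

lemma powr_split_around:
  fixes m x p :: real
  assumes "1 \<le> m"
  shows "(m + 1) powr p = m powr p * (1 + 1 / m) powr p"
    and "(m - 1) powr p = m powr p * (1 - 1 / m) powr p"
proof -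
  have "m + 1 = m * (1 + 1 / m)" "m - 1 = m * (1 - 1 / m)"
    using assms by (auto simp: distrib_left right_diff_distrib)
  then show "(m + 1) powr p = m powr p * (1 + 1 / m) powr p"
    and "(m - 1) powr p = m powr p * (1 - 1 / m) powr p"
    using assms by (metis powr_mult)+
qed

text \<open>Convexity: the tangent bounds for \<open>1 + 1 / m\<close> and \<open>1 - 1 / m\<close>
  add up to 2 because their linear parts cancel. It serves to show that distinct grid increments are
  nonnegatively correlated when \<open>H \<ge> 1/2\<close>.\<close>

lemma powr_second_difference_nonneg:
  fixes m p :: real
  assumes m: "1 \<le> m" and p: "1 \<le> p"
  shows "2 * m powr p \<le> (m + 1) powr p + (m - 1) powr p"
proof -
  have "2 \<le> (1 + 1 / m) powr p + (1 - 1 / m) powr p"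
    using powr_ge_tangent[of "1 + 1 / m" p] powr_ge_tangent[of "1 - 1 / m" p] m p
    by simp
  then have "m powr p * 2 \<le> m powr p * ((1 + 1 / m) powr p + (1 - 1 / m) powr p)"
    by (intro mult_left_mono) auto
  then show ?thesis
    unfolding powr_split_around[OF m] by (simp add: algebra_simps)
qed

text \<open>For a concave power the tangent is an upper bound. A lower bound results from applying
  it to the complementary exponent in \<open>y = y powr p * y powr (1 - p)\<close>. The fraction
  still agrees with \<open>y powr p\<close> to first order at 1, so the error there is
  quadratic.\<close>

lemma powr_ge_rational:
  fixes y p :: real
  assumes y: "0 \<le> y" and p: "0 < p" "p \<le> 1"
  shows "y / (1 + (1 - p) * (y - 1)) \<le> y powr p"
proof (cases "y = 0")
  case False
  define e where "e = 1 + (1 - p) * (y - 1)"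
  have e: "y powr (1 - p) \<le> e"
    using powr_le_tangent[of y "1 - p"] y p by (simp add: e_def algebra_simps)
  have "0 < e"
    using e False y by (smt (verit) powr_gt_zero)
  have "y = y powr p * y powr (1 - p)"
    using False y by (simp flip: powr_add)
  also have "\<dots> \<le> y powr p * e"
    using e by (intro mult_left_mono) auto
  finally have "y / e \<le> y powr p"
    using \<open>0 < e\<close> by (simp add: field_simps)
  then show ?thesis
    by (simp add: e_def)
qed simp

text \<open>With \<open>x = 1 / m\<close> and \<open>q = 1 - p\<close>, the rational lower bounds at
  \<open>1 + x\<close> and \<open>1 - x\<close> add up to
  \<open>(2 - 2 * q * x\<^sup>2) / (1 - (q * x)\<^sup>2)\<close>, which is at least
  \<open>2 - 2 * x\<^sup>2\<close>. The factor \<open>x\<^sup>2\<close> turns the exponent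
  \<open>p\<close> into \<open>p - 2\<close>. This limits how negatively distinct grid increments
  are correlated when \<open>H < 1/2\<close>.\<close>

lemma powr_second_difference_ge:
  fixes m p :: real
  assumes m: "1 \<le> m" and p: "0 < p" "p \<le> 1"
  shows "2 * m powr p - (m + 1) powr p - (m - 1) powr p \<le> 2 * m powr (p - 2)"
proof -
  define x where "x = 1 / m"
  define q where "q = 1 - p"
  have x: "0 < x" "x \<le> 1" and q: "0 \<le> q" "q < 1"
    using m p by (auto simp: x_def q_def)
  have qx: "q * x < 1"
    using x q by (smt (verit) mult_left_le)
  have "2 - 2 * x\<^sup>2 \<le> 2 - 2 * q * x\<^sup>2"
    using q by (simp add: mult_left_le_one_le)
  also have "\<dots> \<le> (2 - 2 * q * x\<^sup>2) / (1 - (q * x)\<^sup>2)"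
  proof -
    have "(q * x)\<^sup>2 < 1"
      using qx x q by (simp add: power_less_one_iff abs_square_less_1)
    moreover have "0 \<le> 2 - 2 * q * x\<^sup>2"
    proof -
      have "q * x\<^sup>2 \<le> 1"
        using x q by (intro mult_le_one) (auto simp: power_le_one)
      then show ?thesis
        by simp
    qed
    ultimately show ?thesis
      by (simp add: pos_le_divide_eq mult_left_le)
  qed
  also have "\<dots> = (1 + x) / (1 + q * x) + (1 - x) / (1 - q * x)"
  proof -
    have "1 + q * x \<noteq> 0" "1 - q * x \<noteq> 0"
      using qx x q by (smt (verit) mult_nonneg_nonneg)+
    then have "(1 + x) / (1 + q * x) + (1 - x) / (1 - q * x)
        = ((1 + x) * (1 - q * x) + (1 - x) * (1 + q * x)) / ((1 + q * x) * (1 - q * x))"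
      by (rule add_frac_eq)
    also have "(1 + x) * (1 - q * x) + (1 - x) * (1 + q * x) = 2 - 2 * q * x\<^sup>2"
      by (simp add: algebra_simps power2_eq_square)
    also have "(1 + q * x) * (1 - q * x) = 1 - (q * x)\<^sup>2"
      by (simp add: algebra_simps power2_eq_square)
    finally show ?thesis
      by simp
  qed
  also have "\<dots> \<le> (1 + x) powr p + (1 - x) powr p"
    using powr_ge_rational[of "1 + x" p] powr_ge_rational[of "1 - x" p] x p
    by (intro add_mono) (auto simp: q_def)
  finally have "m powr p * (2 - (1 + x) powr p - (1 - x) powr p) \<le> m powr p * (2 * x\<^sup>2)"
    by (intro mult_left_mono) auto
  also have "\<dots> = 2 * m powr (p - 2)"
    using m by (simp add: x_def powr_diff power_divide)
  finally show ?thesis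
    unfolding powr_split_around[OF m] x_def by (simp add: algebra_simps)
qed

text \<open>Integral comparison in telescoping form: by the tangent bound at
  \<open>1 - 1 / m\<close>, the term \<open>m powr - p\<close> is at most the increment of
  \<open>x powr (1 - p) / (1 - p)\<close> from \<open>m - 1\<close> to \<open>m\<close>.\<close>

lemma sum_powr_neg_le:
  fixes p :: real
  assumes p: "0 < p" "p < 1"
  shows "(\<Sum>m=1..N. real m powr - p) \<le> real N powr (1 - p) / (1 - p)"
proof (induction N)
  case (Suc N)
  define m where "m = real (Suc N)"
  have m: "1 \<le> m"
    by (simp add: m_def)
  have "(1 - 1 / m) powr (1 - p) \<le> 1 - (1 - p) / m"
    using powr_le_tangent[of "1 - 1 / m" "1 - p"] m p by (simp add: algebra_simps)
  then have "m powr (1 - p) * (1 - 1 / m) powr (1 - p) \<le> m powr (1 - p) * (1 - (1 - p) / m)"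
    by (intro mult_left_mono) auto
  then have "(m - 1) powr (1 - p) \<le> m powr (1 - p) - (1 - p) * (m powr (1 - p) / m)"
    using powr_split_around(2)[OF m] by (simp add: algebra_simps)
  also have "m powr (1 - p) / m = m powr - p"
    using m by (simp add: powr_diff powr_minus_divide)
  finally have "(m - 1) powr (1 - p) / (1 - p) \<le> (m powr (1 - p) - (1 - p) * m powr - p) / (1 - p)"
    using p by (intro divide_right_mono) auto
  also have "\<dots> = m powr (1 - p) / (1 - p) - m powr - p"
    using p by (simp add: diff_divide_distrib)
  finally have "real N powr (1 - p) / (1 - p) + m powr - p \<le> m powr (1 - p) / (1 - p)"
    by (simp add: m_def)
  with Suc show ?case
    by (simp add: m_def)
qed simp

section \<open>Fractional Brownian motion\<close>

locale fbm = prob_space M for M :: "'w measure" +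
  fixes H :: real and B :: "real \<Rightarrow> 'w \<Rightarrow> real"
  assumes H_pos: "0 < H"
    and fbm: "fractional_brownian_motion M H B"
begin

definition R :: "real \<Rightarrow> real \<Rightarrow> real" where
  "R s t = (s powr (2 * H) + t powr (2 * H) - \<bar>s - t\<bar> powr (2 * H)) / 2"

lemma R_0 [simp]: "R 0 t = 0" "R t 0 = 0" if "0 \<le> t"
  using that by (auto simp: R_def)

lemma inner_B:
  assumes "0 \<le> s" "0 \<le> t"
  shows "l2_inner M (B s) (B t) = R s t"
  using fbm assms by (simp add: fractional_brownian_motion_def l2_inner_real R_def)

lemma measurable_B: "B t \<in> borel_measurable M" if "0 \<le> t"
proof -
  have "gaussian_process M {0..} B"
    using fbm by (simp add: fractional_brownian_motion_def)
  then have "finite {t} \<and> {t} \<subseteq> {0..} \<longrightarrow> gaussian_rv M (\<lambda>\<omega>. \<Sum>s\<in>{t}. 1 * B s \<omega>)"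
    unfolding gaussian_process_def by (elim allE)
  then have "gaussian_rv M (\<lambda>\<omega>. \<Sum>s\<in>{t}. 1 * B s \<omega>)"
    using that by simp
  then show ?thesis
    by (simp add: gaussian_rv_def)
qed

text \<open>A Bochner integral that is not \<open>0\<close> exists, so square integrability can be read off from the
  covariance.\<close>
lemma B_L2: "B t \<in> L2 M" if "0 \<le> t"
proof (cases "t = 0")
  case True
  have "AE \<omega> in M. B t \<omega> = 0"
    using fbm True by (simp add: fractional_brownian_motion_def)
  then have "AE \<omega> in M. \<bar>B t \<omega>\<bar> \<le> 0"
    by simp
  then show ?thesis
    by (intro L2_bounded measurable_B that finite_measure_axioms)
next
  case False
  have "(\<integral>\<omega>. B t \<omega> * B t \<omega> \<partial>M) = t powr (2 * H)"
    using inner_B[OF that that] by (simp add: l2_inner_real R_def)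
  then have "(\<integral>\<omega>. B t \<omega> * B t \<omega> \<partial>M) \<noteq> 0"
    using False that by simp
  then have "integrable M (\<lambda>\<omega>. B t \<omega> * B t \<omega>)"
    using not_integrable_integral_eq by blast
  then show ?thesis
    using measurable_B[OF that] by (simp add: L2_def)
qed

lemma mean_B: "(\<integral>\<omega>. B t \<omega> \<partial>M) = 0" if "0 \<le> t"
  using fbm that by (simp add: fractional_brownian_motion_def)

lemma norm_B: "l2_norm M (B t) = t powr H" if "0 \<le> t"
  using inner_B[OF that that] that
  by (simp add: l2_norm_def R_def powr_half_sqrt[symmetric] powr_powr)

lemma inner_increments:
  assumes "0 \<le> a" "0 \<le> b" "0 \<le> c" "0 \<le> d"
  shows "l2_inner M (\<lambda>\<omega>. B b \<omega> - B a \<omega>) (\<lambda>\<omega>. B d \<omega> - B c \<omega>) = R b d - R b c - R a d + R a c"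
  using assms by (simp add: l2_inner_diff_left l2_inner_diff_right B_L2 L2_diff inner_B)

lemma norm_increment:
  assumes "0 \<le> s" "0 \<le> t"
  shows "l2_norm M (\<lambda>\<omega>. B t \<omega> - B s \<omega>) = \<bar>t - s\<bar> powr H"
proof -
  have "l2_inner M (\<lambda>\<omega>. B t \<omega> - B s \<omega>) (\<lambda>\<omega>. B t \<omega> - B s \<omega>) = \<bar>t - s\<bar> powr (2 * H)"
    unfolding inner_increments[OF assms assms] by (simp add: R_def abs_minus_commute field_simps)
  then show ?thesis
    by (simp add: l2_norm_def powr_half_sqrt[symmetric] powr_powr)
qed

lemma step_integral_L2: "step_integral B J c \<in> L2 M" if "J \<subseteq> {0..}"
  unfolding step_integral_def using that by (intro L2_sum L2_cmult B_L2) auto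

lemma inner_step_integral:
  assumes "J \<subseteq> {0..}" "Y \<in> L2 M"
  shows "l2_inner M (step_integral B J c) Y = (\<Sum>r\<in>J. c r * l2_inner M (B r) Y)"
proof -
  have "l2_inner M (step_integral B J c) Y = (\<Sum>r\<in>J. l2_inner M (\<lambda>\<omega>. c r * B r \<omega>) Y)"
    unfolding step_integral_def using assms by (intro l2_inner_sum_left L2_cmult B_L2) auto
  then show ?thesis
    by (simp add: l2_inner_cmult_left)
qed

lemma const_L2: "(\<lambda>\<omega>. c) \<in> L2 M" for c :: real
  by (simp add: L2_def)

text \<open>The mean is written as the inner product with the constant 1 so that it passes to limits
  in \<open>L2 M\<close>.\<close>

lemma mean_step_integral: "l2_inner M (step_integral B J c) (\<lambda>\<omega>. 1) = 0" if "J \<subseteq> {0..}"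
proof -
  have "l2_inner M (B r) (\<lambda>\<omega>. 1) = 0" if "r \<in> J" for r
    using mean_B[of r] that \<open>J \<subseteq> {0..}\<close> by (auto simp: l2_inner_real)
  then show ?thesis
    using that by (simp add: inner_step_integral const_L2)
qed

end

section \<open>Uniqueness of the Wiener integral\<close>

text \<open>The signed power is an antiderivative on the whole line, so covariances can be
  integrated without splitting by sign. At 0 the difference quotient is
  \<open>\<bar>h\<bar> powr p / (p + 1)\<close>, which tends to 0 because
  \<open>0 < p\<close>.\<close>

lemma DERIV_mult_abs_powr:
  fixes p x :: real
  assumes p: "0 < p"
  shows "((\<lambda>x. x * \<bar>x\<bar> powr p / (p + 1)) has_real_derivative \<bar>x\<bar> powr p) (at x)"
proof -
  consider "0 < x" | "x < 0" | "x = 0"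
    by linarith
  then show ?thesis
  proof cases
    case 1
    have "((\<lambda>x. x powr (p + 1) / (p + 1)) has_real_derivative \<bar>x\<bar> powr p) (at x)"
      using 1 p by (auto intro!: derivative_eq_intros)
    then show ?thesis
      by (rule has_field_derivative_transform_within_open[where S = "{0<..}"])
        (use 1 in \<open>auto simp: powr_add\<close>)
  next
    case 2
    have "((\<lambda>x. - ((- x) powr (p + 1)) / (p + 1)) has_real_derivative \<bar>x\<bar> powr p) (at x)"
      using 2 p by (auto intro!: derivative_eq_intros)
    then show ?thesis
      by (rule has_field_derivative_transform_within_open[where S = "{..<0}"])
        (use 2 in \<open>auto simp: powr_add\<close>)
  next
    case 3
    have "((\<lambda>h::real. \<bar>h\<bar> powr p / (p + 1)) \<longlongrightarrow> \<bar>0\<bar> powr p / (p + 1)) (at 0)"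
      using p by (intro tendsto_intros) auto
    then have "((\<lambda>h::real. \<bar>h\<bar> powr p / (p + 1)) \<longlongrightarrow> 0) (at 0)"
      by simp
    then have "((\<lambda>h::real. h * \<bar>h\<bar> powr p / (p + 1) / h) \<longlongrightarrow> 0) (at 0)"
      by (rule Lim_transform_eventually) (auto simp: eventually_at_filter)
    then show ?thesis
      using 3 by (simp add: has_field_derivative_iff)
  qed
qed

lemma DERIV_mult_abs_powr_compose:
  fixes p x :: real
  assumes "0 < p" "(g has_real_derivative D) (at x within S)"
  shows "((\<lambda>x. g x * \<bar>g x\<bar> powr p / (p + 1)) has_real_derivative \<bar>g x\<bar> powr p * D) (at x within S)"
  using DERIV_chain2[OF DERIV_mult_abs_powr[OF assms(1)] assms(2)] .

section \<open>Square integrability on a bounded interval\<close>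

lemma finite_measure_lebesgue_on_Icc: "finite_measure (lebesgue_on {a..b::real})"
  by (rule finite_measureI) (simp add: emeasure_restrict_space emeasure_lborel_Icc_eq)

lemma indicator_L2: "(indicator {0..t} :: real \<Rightarrow> real) \<in> L2 (lebesgue_on {0..T})"
proof (rule L2_bounded[OF finite_measure_lebesgue_on_Icc])
  show "(indicator {0..t} :: real \<Rightarrow> real) \<in> borel_measurable (lebesgue_on {0..T})"
    by (intro measurable_restrict_space1 borel_measurable_indicator) simp
  show "AE x in lebesgue_on {0..T}. \<bar>indicator {0..t} x :: real\<bar> \<le> 1"
    by (simp add: indicator_def)
qed

lemma step_function_L2: "step_function J c \<in> L2 (lebesgue_on {0..T})"
  unfolding step_function_def[abs_def] by (intro L2_sum L2_cmult indicator_L2)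

lemma continuous_L2:
  fixes \<psi> :: "real \<Rightarrow> real"
  assumes "continuous_on {a..b} \<psi>"
  shows "\<psi> \<in> L2 (lebesgue_on {a..b})"
proof -
  obtain K where "\<forall>y\<in>\<psi> ` {a..b}. norm y \<le> K"
    using compact_imp_bounded[OF compact_continuous_image[OF assms compact_Icc]]
    unfolding bounded_iff by blast
  then have "AE x in lebesgue_on {a..b}. \<bar>\<psi> x\<bar> \<le> K"
    by (intro AE_I2) (simp add: space_restrict_space)
  then show ?thesis
    using continuous_imp_measurable_on_sets_lebesgue[OF assms]
    by (intro L2_bounded[OF finite_measure_lebesgue_on_Icc]) auto
qed

lemma l2_inner_indicator:
  fixes k :: "real \<Rightarrow> real"
  assumes "continuous_on {0..r} k" "r \<le> T"
  shows "l2_inner (lebesgue_on {0..T}) (indicator {0..r}) k = integral {0..r} k"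
proof -
  have "l2_inner (lebesgue_on {0..T}) (indicator {0..r}) k
      = (\<integral>x. indicator {0..T} x *\<^sub>R (indicator {0..r} x * k x) \<partial>lebesgue)"
    unfolding l2_inner_real by (subst integral_restrict_space) auto
  also have "\<dots> = (\<integral>x. indicator {0..r} x *\<^sub>R k x \<partial>lebesgue)"
    using assms(2) by (intro Bochner_Integration.integral_cong) (auto simp: indicator_def)
  also have "\<dots> = (\<integral>x. k x \<partial>lebesgue_on {0..r})"
    by (subst integral_restrict_space) auto
  also have "\<dots> = integral {0..r} k"
    using assms(1) by (intro lebesgue_integral_eq_integral continuous_imp_integrable_real) auto
  finally show ?thesis .
qed

lemma continuous_on_abs_powr:
  fixes g :: "'x::topological_space \<Rightarrow> real"
  assumes "0 < p" "continuous_on S g"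
  shows "continuous_on S (\<lambda>x. \<bar>g x\<bar> powr p)"
  using assms by (intro continuous_on_powr' continuous_intros) auto

section \<open>Averaged covariances with increments\<close>

context fbm
begin

text \<open>Pairing a step function with this kernel gives the average over \<open>t \<in> [0,x]\<close> of the
  covariance of its integral with \<open>B (t + d) - B t\<close>. Taking an increment in \<open>t\<close> and averaging
  removes the singularities of the derivative of the covariance when \<open>H < 1/2\<close>, so that the
  kernel is bounded.\<close>
definition kernel :: "real \<Rightarrow> real \<Rightarrow> real \<Rightarrow> real" where
  "kernel d x r = (\<bar>r - x - d\<bar> powr (2 * H) - \<bar>r - x\<bar> powr (2 * H)
     - \<bar>r - d\<bar> powr (2 * H) + \<bar>r\<bar> powr (2 * H)) / 2"

lemma continuous_kernel: "continuous_on S (kernel d x)"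
  unfolding kernel_def using H_pos by (intro continuous_intros continuous_on_abs_powr) auto

text \<open>Both integrals are the same mixed difference of one function: \<open>F r\<close> is an
  antiderivative of the covariance increment in \<open>t\<close>, while \<open>F s x - F s 0\<close>
  is an antiderivative of the kernel in \<open>s\<close>.\<close>

lemma has_integral_R_increment:
  assumes r: "0 \<le> r" and d: "0 \<le> d" and x: "0 \<le> x"
  shows "((\<lambda>t. R r (t + d) - R r t) has_integral integral {0..r} (kernel d x)) {0..x}"
proof -
  define Q where "Q y = y * \<bar>y\<bar> powr (2 * H) / (2 * H + 1)" for y :: real
  have Q: "((\<lambda>y. Q (g y)) has_real_derivative \<bar>g y\<bar> powr (2 * H) * D) (at y within S)"
    if "(g has_real_derivative D) (at y within S)" for g D y S
    unfolding Q_def using that H_pos by (intro DERIV_mult_abs_powr_compose) auto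
  \<comment> \<open>Oddness makes \<open>F 0 t\<close> vanish for every \<open>t\<close>, so the
    lower limit \<open>s = 0\<close> contributes nothing.\<close>
  have Q_odd: "Q (- y) = - Q y" for y
    by (simp add: Q_def)
  define F where "F s t = (Q (t + d) - Q t + Q (s - t - d) - Q (s - t)) / 2" for s t
  have "((\<lambda>t. R r (t + d) - R r t) has_integral F r x - F r 0) {0..x}"
  proof (rule fundamental_theorem_of_calculus[OF x])
    fix t assume "t \<in> {0..x}"
    then have "R r (t + d) - R r t = (\<bar>t + d\<bar> powr (2 * H) * 1 - \<bar>t\<bar> powr (2 * H) * 1
        + \<bar>r - t - d\<bar> powr (2 * H) * (- 1) - \<bar>r - t\<bar> powr (2 * H) * (- 1)) / 2"
      using d by (simp add: R_def diff_diff_eq diff_divide_distrib add_divide_distrib)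
    moreover have "(F r has_real_derivative (\<bar>t + d\<bar> powr (2 * H) * 1 - \<bar>t\<bar> powr (2 * H) * 1
        + \<bar>r - t - d\<bar> powr (2 * H) * (- 1) - \<bar>r - t\<bar> powr (2 * H) * (- 1)) / 2) (at t within {0..x})"
      unfolding F_def by (intro DERIV_cdivide DERIV_add DERIV_diff Q) (auto intro!: derivative_eq_intros)
    ultimately show "(F r has_vector_derivative R r (t + d) - R r t) (at t within {0..x})"
      by (metis has_real_derivative_iff_has_vector_derivative)
  qed
  moreover have "(kernel d x has_integral (F r x - F r 0) - (F 0 x - F 0 0)) {0..r}"
  proof (rule fundamental_theorem_of_calculus[OF r])
    fix s assume "s \<in> {0..r}"
    have "((\<lambda>s. F s x - F s 0) has_real_derivative
        (0 - 0 + \<bar>s - x - d\<bar> powr (2 * H) * 1 - \<bar>s - x\<bar> powr (2 * H) * 1) / 2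
        - (0 - 0 + \<bar>s - 0 - d\<bar> powr (2 * H) * 1 - \<bar>s - 0\<bar> powr (2 * H) * 1) / 2) (at s within {0..r})"
      unfolding F_def by (intro DERIV_cdivide DERIV_add DERIV_diff Q) (auto intro!: derivative_eq_intros)
    then show "((\<lambda>s. F s x - F s 0) has_vector_derivative kernel d x s) (at s within {0..r})"
      by (simp add: has_real_derivative_iff_has_vector_derivative kernel_def
          diff_divide_distrib add_divide_distrib algebra_simps)
  qed
  moreover have "F 0 x - F 0 0 = 0"
    using Q_odd[of "x + d"] Q_odd[of x] Q_odd[of d] by (simp add: F_def) (simp add: Q_def)
  ultimately show ?thesis
    by (metis diff_zero integral_unique)
qed

lemma has_integral_inner_increment:
  assumes J: "finite J" "J \<subseteq> {0..T}" and d: "0 \<le> d" and x: "0 \<le> x"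
  shows "((\<lambda>t. l2_inner M (step_integral B J c) (\<lambda>\<omega>. B (t + d) \<omega> - B t \<omega>)) has_integral
     l2_inner (lebesgue_on {0..T}) (step_function J c) (kernel d x)) {0..x}"
proof -
  have J0: "J \<subseteq> {0..}"
    using J by auto
  have "l2_inner (lebesgue_on {0..T}) (step_function J c) (kernel d x)
      = (\<Sum>r\<in>J. l2_inner (lebesgue_on {0..T}) (\<lambda>\<tau>. c r * indicator {0..r} \<tau>) (kernel d x))"
    unfolding step_function_def[abs_def]
    by (intro l2_inner_sum_left L2_cmult indicator_L2 continuous_L2 continuous_kernel)
  also have "\<dots> = (\<Sum>r\<in>J. c r * integral {0..r} (kernel d x))"
    using J by (intro sum.cong) (auto simp: l2_inner_cmult_left l2_inner_indicator continuous_kernel)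
  finally have eq: "l2_inner (lebesgue_on {0..T}) (step_function J c) (kernel d x)
      = (\<Sum>r\<in>J. c r * integral {0..r} (kernel d x))" .
  have "((\<lambda>t. \<Sum>r\<in>J. c r * (R r (t + d) - R r t)) has_integral
      (\<Sum>r\<in>J. c r * integral {0..r} (kernel d x))) {0..x}"
    using J d x by (intro has_integral_sum has_integral_mult_right has_integral_R_increment) auto
  moreover have "(\<Sum>r\<in>J. c r * (R r (t + d) - R r t))
      = l2_inner M (step_integral B J c) (\<lambda>\<omega>. B (t + d) \<omega> - B t \<omega>)" if "t \<in> {0..x}" for t
  proof -
    have "l2_inner M (B r) (\<lambda>\<omega>. B (t + d) \<omega> - B t \<omega>) = R r (t + d) - R r t" if "r \<in> J" for r
      using that \<open>t \<in> {0..x}\<close> d J0 by (auto simp: l2_inner_diff_right B_L2 inner_B)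
    then show ?thesis
      using that d J0 by (simp add: inner_step_integral B_L2 L2_diff)
  qed
  ultimately show ?thesis
    unfolding eq by (rule has_integral_eq[rotated])
qed

text \<open>Cauchy-Schwarz and \<open>norm_increment\<close> give Hoelder continuity of exponent
  \<open>H\<close>.\<close>

lemma continuous_inner_B:
  assumes Z: "Z \<in> L2 M"
  shows "continuous_on {0..} (\<lambda>t. l2_inner M Z (B t))"
  unfolding continuous_on_def
proof
  fix t :: real assume t: "t \<in> {0..}"
  show "((\<lambda>t. l2_inner M Z (B t)) \<longlongrightarrow> l2_inner M Z (B t)) (at t within {0..})"
  proof (rule LIM_zero_cancel, rule Lim_null_comparison)
    have "\<bar>l2_inner M Z (B s) - l2_inner M Z (B t)\<bar> \<le> l2_norm M Z * \<bar>s - t\<bar> powr H" if "0 \<le> s" for s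
      using l2_Cauchy_Schwarz[OF Z L2_diff[OF B_L2[of s] B_L2[of t]]] norm_increment[of t s] that t
      by (simp add: l2_inner_diff_right Z B_L2)
    then show "\<forall>\<^sub>F s in at t within {0..}.
        norm (l2_inner M Z (B s) - l2_inner M Z (B t)) \<le> l2_norm M Z * \<bar>s - t\<bar> powr H"
      by (auto simp: eventually_at_filter)
    have "((\<lambda>s. l2_norm M Z * \<bar>s - t\<bar> powr H) \<longlongrightarrow> l2_norm M Z * \<bar>t - t\<bar> powr H) (at t within {0..})"
      using H_pos by (intro tendsto_intros tendsto_powr') auto
    then show "((\<lambda>s. l2_norm M Z * \<bar>s - t\<bar> powr H) \<longlongrightarrow> 0) (at t within {0..})"
      by simp
  qed
qed

lemma continuous_inner_increment:
  assumes Z: "Z \<in> L2 M" and d: "0 \<le> d"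
  shows "continuous_on {0..x} (\<lambda>t. l2_inner M Z (\<lambda>\<omega>. B (t + d) \<omega> - B t \<omega>))"
proof -
  have "continuous_on {0..x} (\<lambda>t. l2_inner M Z (B (t + d)) - l2_inner M Z (B t))"
    using d by (intro continuous_on_diff continuous_on_compose2[OF continuous_inner_B[OF Z]]
        continuous_intros) auto
  then show ?thesis
    by (rule continuous_on_eq) (use d in \<open>auto simp: l2_inner_diff_right Z B_L2\<close>)
qed

text \<open>The identity for step functions passes to the limit on both sides. On the left the
  convergence is uniform in \<open>t\<close>, since every increment over a length \<open>d\<close>
  has norm \<open>d powr H\<close>; on the right the continuous kernel lies in L2 over
  \<open>{0..T}\<close>, so pairing with it is continuous.\<close>

lemma wiener_integral_average:
  assumes X: "is_wiener_integral M B T \<psi> X" and d: "0 \<le> d" and x: "0 \<le> x"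
  shows "((\<lambda>t. l2_inner M X (\<lambda>\<omega>. B (t + d) \<omega> - B t \<omega>)) has_integral
     l2_inner (lebesgue_on {0..T}) \<psi> (kernel d x)) {0..x}"
proof -
  let ?L = "lebesgue_on {0..T}"
  obtain J c where J: "\<And>n. finite (J n)" "\<And>n. J n \<subseteq> {0..T}"
    and s: "l2_tendsto ?L (\<lambda>n. step_function (J n) (c n)) \<psi>"
    and I: "l2_tendsto M (\<lambda>n. step_integral B (J n) (c n)) X"
    and \<psi>: "\<psi> \<in> L2 ?L" and X2: "X \<in> L2 M"
    using X by (auto simp: is_wiener_integral_def)
  define In where "In n = step_integral B (J n) (c n)" for n
  define G where "G Y t = l2_inner M Y (\<lambda>\<omega>. B (t + d) \<omega> - B t \<omega>)" for Y t
  have In: "In n \<in> L2 M" for n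
    unfolding In_def using J(2)[of n] by (intro step_integral_L2) auto
  have Gn: "(G (In n) has_integral l2_inner ?L (step_function (J n) (c n)) (kernel d x)) {0..x}" for n
    unfolding G_def In_def using J d x by (intro has_integral_inner_increment) auto
  have close: "\<bar>G (In n) t - G X t\<bar> \<le> l2_norm M (\<lambda>\<omega>. In n \<omega> - X \<omega>) * d powr H" if "0 \<le> t" for n t
  proof -
    have B2: "(\<lambda>\<omega>. B (t + d) \<omega> - B t \<omega>) \<in> L2 M"
      using that d by (intro L2_diff B_L2) auto
    have "G (In n) t - G X t = l2_inner M (\<lambda>\<omega>. In n \<omega> - X \<omega>) (\<lambda>\<omega>. B (t + d) \<omega> - B t \<omega>)"
      unfolding G_def by (simp add: l2_inner_diff_left In X2 B2)
    then show ?thesis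
      using l2_Cauchy_Schwarz[OF L2_diff[OF In[of n] X2] B2] norm_increment[of t "t + d"] that d
      by simp
  qed
  have "uniform_limit {0..x} (\<lambda>n. G (In n)) (G X) sequentially"
    unfolding uniform_limit_iff
  proof (intro allI impI)
    fix e :: real assume "0 < e"
    have "(\<lambda>n. l2_norm M (\<lambda>\<omega>. In n \<omega> - X \<omega>) * d powr H) \<longlonglongrightarrow> 0 * d powr H"
      using I by (intro tendsto_intros) (simp add: l2_tendsto_def In_def)
    then have "\<forall>\<^sub>F n in sequentially. l2_norm M (\<lambda>\<omega>. In n \<omega> - X \<omega>) * d powr H < e"
      using \<open>0 < e\<close> by (intro order_tendstoD(2)[where y = "0 * d powr H"]) auto
    then show "\<forall>\<^sub>F n in sequentially. \<forall>t\<in>{0..x}. dist (G (In n) t) (G X t) < e"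
      by eventually_elim (auto simp: dist_real_def intro: le_less_trans[OF close])
  qed
  then obtain I' K where "\<And>n. (G (In n) has_integral I' n) {0..x}" "(G X has_integral K) {0..x}"
      "I' \<longlonglongrightarrow> K"
    by (rule uniform_limit_integral)
      (use d in \<open>auto simp: G_def[abs_def] intro!: continuous_inner_increment In\<close>)
  moreover from this Gn have "I' = (\<lambda>n. l2_inner ?L (step_function (J n) (c n)) (kernel d x))"
    by (metis has_integral_unique ext)
  moreover have "(\<lambda>n. l2_inner ?L (step_function (J n) (c n)) (kernel d x))
      \<longlonglongrightarrow> l2_inner ?L \<psi> (kernel d x)"
    by (intro l2_inner_tendsto step_function_L2 \<psi> s continuous_L2 continuous_kernel)
  ultimately show ?thesis
    using LIMSEQ_unique unfolding G_def by blast
qed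

text \<open>Differentiating the vanishing averages at \<open>x = 0\<close> recovers the integrand at
  \<open>t = 0\<close>, which is the covariance of \<open>Z\<close> with
  \<open>B d - B 0\<close>.\<close>

lemma orthogonal_if_averages_vanish:
  assumes Z: "Z \<in> L2 M" and d: "0 \<le> d"
    and avg: "\<And>x. 0 \<le> x \<Longrightarrow> ((\<lambda>t. l2_inner M Z (\<lambda>\<omega>. B (t + d) \<omega> - B t \<omega>)) has_integral 0) {0..x}"
  shows "l2_inner M Z (B d) = 0"
proof -
  define F where "F t = l2_inner M Z (B t)" for t
  define G where "G t = F (t + d) - F t" for t
  have G: "l2_inner M Z (\<lambda>\<omega>. B (t + d) \<omega> - B t \<omega>) = G t" if "0 \<le> t" for t
    using that d by (simp add: G_def F_def l2_inner_diff_right Z B_L2)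
  have G_cont: "continuous_on {0..1} G"
    using continuous_on_eq[OF continuous_inner_increment[OF Z d] G] by auto
  have "((\<lambda>x. integral {0..x} G) has_vector_derivative G 0) (at 0 within {0..1})"
    by (rule integral_has_vector_derivative[OF G_cont]) simp
  moreover have "integral {0..x} G = 0" if "x \<in> {0..1}" for x
    using that by (intro integral_unique has_integral_eq[OF G avg]) auto
  ultimately have "((\<lambda>x. 0) has_vector_derivative G 0) (at 0 within {0..1})"
    by (intro has_vector_derivative_transform[of 0 "{0..1}" "\<lambda>x. 0" "\<lambda>x. integral {0..x} G"]) auto
  then have "G 0 = 0"
    using vector_derivative_unique_within[of 0 "{0..1}" "\<lambda>x. 0::real" "G 0" 0]
    by (simp add: at_within_Icc_at_right)
  \<comment> \<open>\<open>B 0\<close> has norm \<open>0 powr H = 0\<close>, so its pairing with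
    \<open>Z\<close> is 0.\<close>
  moreover have "F 0 = 0"
    using l2_Cauchy_Schwarz[OF Z B_L2[of 0]] norm_B[of 0] by (simp add: F_def)
  ultimately show ?thesis
    by (simp add: G_def F_def)
qed

text \<open>The averages of \<open>X\<close> and \<open>X'\<close> depend only on
  \<open>\<psi>\<close>, so the difference \<open>Z\<close> is orthogonal to every
  \<open>B d\<close>. Hence it is orthogonal to all step integrals and to their limits
  \<open>X\<close> and \<open>X'\<close>, and therefore to itself.\<close>

lemma wiener_integral_unique:
  assumes X: "is_wiener_integral M B T \<psi> X" and X': "is_wiener_integral M B T \<psi> X'"
  shows "AE \<omega> in M. X \<omega> = X' \<omega>"
proof -
  define Z where "Z = (\<lambda>\<omega>. X \<omega> - X' \<omega>)"
  have X2: "X \<in> L2 M" and X2': "X' \<in> L2 M"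
    using X X' by (auto simp: is_wiener_integral_def)
  then have Z: "Z \<in> L2 M"
    unfolding Z_def by auto
  have ZB: "l2_inner M Z (B d) = 0" if "0 \<le> d" for d
  proof (rule orthogonal_if_averages_vanish[OF Z that])
    fix x :: real assume x: "0 \<le> x"
    have "l2_inner M Z (\<lambda>\<omega>. B (t + d) \<omega> - B t \<omega>) =
        l2_inner M X (\<lambda>\<omega>. B (t + d) \<omega> - B t \<omega>) - l2_inner M X' (\<lambda>\<omega>. B (t + d) \<omega> - B t \<omega>)"
      if "t \<in> {0..x}" for t
      using that \<open>0 \<le> d\<close> by (simp add: Z_def l2_inner_diff_left X2 X2' L2_diff B_L2)
    then show "((\<lambda>t. l2_inner M Z (\<lambda>\<omega>. B (t + d) \<omega> - B t \<omega>)) has_integral 0) {0..x}"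
      using has_integral_eq[OF sym has_integral_diff[OF wiener_integral_average[OF X that x]
            wiener_integral_average[OF X' that x]]] by simp
  qed
  have Z_orth: "l2_inner M Z Y = 0" if Y: "is_wiener_integral M B T \<psi> Y" for Y
  proof -
    obtain J c where J: "\<And>n. J n \<subseteq> {0..T}"
      and I: "l2_tendsto M (\<lambda>n. step_integral B (J n) (c n)) Y" and Y2: "Y \<in> L2 M"
      using Y by (auto simp: is_wiener_integral_def)
    have J0: "J n \<subseteq> {0..}" for n
      using J[of n] by auto
    have "(\<lambda>n. l2_inner M (step_integral B (J n) (c n)) Z) \<longlonglongrightarrow> l2_inner M Y Z"
      using J0 by (intro l2_inner_tendsto step_integral_L2 Y2 Z I)
    moreover have "l2_inner M (step_integral B (J n) (c n)) Z = 0" for n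
    proof -
      have "l2_inner M (B r) Z = 0" if "r \<in> J n" for r
        using ZB[of r] J0[of n] that by (auto simp: l2_inner_commute[of M _ Z])
      then show ?thesis
        by (simp add: inner_step_integral[OF J0 Z])
    qed
    ultimately show ?thesis
      by (simp add: LIMSEQ_const_iff l2_inner_commute)
  qed
  have "l2_inner M Z Z = l2_inner M Z X - l2_inner M Z X'"
    unfolding Z_def by (rule l2_inner_diff_right) (use X2 X2' Z in \<open>auto simp: Z_def\<close>)
  then have "l2_norm M Z = 0"
    using Z_orth[OF X] Z_orth[OF X'] by (simp add: l2_norm_def)
  then show ?thesis
    using Z by (simp add: l2_norm_eq_0_iff) (simp add: Z_def)
qed

end

section \<open>Wiener integrals of Lipschitz functions\<close>

text \<open>The integrator \<open>G\<close> is a parameter because it is used both as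
  \<open>t \<mapsto> indicator {0..t} \<tau>\<close>, which yields the approximating step function,
  and as \<open>t \<mapsto> B t \<omega>\<close>, which yields its integral.\<close>

definition riemann_sum :: "(real \<Rightarrow> real) \<Rightarrow> real \<Rightarrow> (real \<Rightarrow> real) \<Rightarrow> nat \<Rightarrow> real" where
  "riemann_sum \<psi> T G N =
     (\<Sum>i<N. \<psi> (real i * (T / real N)) * (G (real (Suc i) * (T / real N)) - G (real i * (T / real N))))"

lemma grid_mem:
  assumes "0 \<le> T" "i \<le> N"
  shows "real i * (T / real N) \<in> {0..T}"
proof (cases "N = 0")
  case False
  have "real i * T \<le> real N * T"
    using assms by (intro mult_right_mono) auto
  with False assms show ?thesis
    by (simp add: field_simps)
qed (use assms in simp)

text \<open>Increments are regrouped by node. Nodes may coincide, so \<open>c r\<close> collects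
  every cell that starts or ends at \<open>r\<close>. As \<open>J\<close> and \<open>c\<close> do
  not depend on \<open>G\<close>, one pair represents both the step function and its
  integral.\<close>

lemma increments_as_step:
  fixes a :: "nat \<Rightarrow> real" and t :: "nat \<Rightarrow> real"
  obtains J c where "finite J" "J \<subseteq> t ` {..N}"
    "\<And>G. (\<Sum>r\<in>J. c r * G r) = (\<Sum>i<N. a i * (G (t (Suc i)) - G (t i)))"
proof -
  define J where "J = t ` {..N}"
  define c where "c r = (\<Sum>i<N. a i * (of_bool (r = t (Suc i)) - of_bool (r = t i)))" for r
  have fin: "finite J"
    by (simp add: J_def)
  have "(\<Sum>r\<in>J. c r * G r) = (\<Sum>i<N. a i * (G (t (Suc i)) - G (t i)))" for G
  proof -
    have "(\<Sum>r\<in>J. c r * G r)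
        = (\<Sum>i<N. \<Sum>r\<in>J. a i * (of_bool (r = t (Suc i)) - of_bool (r = t i)) * G r)"
      unfolding c_def sum_distrib_right by (rule sum.swap)
    also have "\<dots> = (\<Sum>i<N. a i * (G (t (Suc i)) - G (t i)))"
    proof (rule sum.cong[OF refl])
      fix i assume "i \<in> {..<N}"
      then have mem: "t (Suc i) \<in> J" "t i \<in> J"
        by (auto simp: J_def)
      have pick: "(\<Sum>r\<in>J. of_bool (r = s) * G r) = G s" if "s \<in> J" for s
      proof -
        have "(\<Sum>r\<in>J. of_bool (r = s) * G r) = (\<Sum>r\<in>J. if r = s then G r else 0)"
          by (intro sum.cong) auto
        then show ?thesis
          using that fin by simp
      qed
      have "(\<Sum>r\<in>J. a i * (of_bool (r = t (Suc i)) - of_bool (r = t i)) * G r)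
          = a i * ((\<Sum>r\<in>J. of_bool (r = t (Suc i)) * G r) - (\<Sum>r\<in>J. of_bool (r = t i) * G r))"
        by (simp add: sum_distrib_left sum_subtractf[symmetric] algebra_simps)
      also have "\<dots> = a i * (G (t (Suc i)) - G (t i))"
        by (simp add: pick mem)
      finally show "(\<Sum>r\<in>J. a i * (of_bool (r = t (Suc i)) - of_bool (r = t i)) * G r)
          = a i * (G (t (Suc i)) - G (t i))" .
    qed
    finally show ?thesis .
  qed
  then show ?thesis
    using that fin unfolding J_def by blast
qed

lemma riemann_sum_as_step:
  fixes B :: "real \<Rightarrow> 'w \<Rightarrow> real"
  assumes T: "0 \<le> T"
  obtains J c where "finite J" "J \<subseteq> {0..T}"
    "step_function J c = (\<lambda>\<tau>. riemann_sum \<psi> T (\<lambda>t. indicator {0..t} \<tau>) N)"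
    "step_integral B J c = (\<lambda>\<omega>. riemann_sum \<psi> T (\<lambda>t. B t \<omega>) N)"
proof -
  obtain J c where J: "finite J" "J \<subseteq> (\<lambda>i. real i * (T / real N)) ` {..N}"
    and eq: "\<And>G. (\<Sum>r\<in>J. c r * G r) = riemann_sum \<psi> T G N"
    by (rule increments_as_step[of "\<lambda>i. real i * (T / real N)" N "\<lambda>i. \<psi> (real i * (T / real N))"])
      (auto simp: riemann_sum_def)
  moreover have "J \<subseteq> {0..T}"
    using J grid_mem[OF T] by auto
  moreover have "step_function J c = (\<lambda>\<tau>. riemann_sum \<psi> T (\<lambda>t. indicator {0..t} \<tau>) N)"
    "step_integral B J c = (\<lambda>\<omega>. riemann_sum \<psi> T (\<lambda>t. B t \<omega>) N)"
    by (simp_all only: step_function_def[abs_def] step_integral_def[abs_def] eq)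
  ultimately show ?thesis
    using that by blast
qed

text \<open>Exactly one half-open cell, open on the left, contains \<open>\<tau>\<close>, and the
  sum picks the value of \<open>\<psi>\<close> at its left end. The point 0 is excluded because
  there all indicators equal 1 and the sum is 0.\<close>

lemma riemann_step_close:
  assumes T: "0 < T" and lip: "L-lipschitz_on {0..T} \<psi>" and N: "0 < N" and \<tau>: "0 < \<tau>" "\<tau> \<le> T"
  shows "\<bar>riemann_sum \<psi> T (\<lambda>t. indicator {0..t} \<tau>) N - \<psi> \<tau>\<bar> \<le> L * (T / real N)"
proof -
  define t where "t i = real i * (T / real N)" for i
  define e where "e i = (indicator {0..t (Suc i)} \<tau> - indicator {0..t i} \<tau> :: real)" for i
  have t_Suc: "t (Suc i) = t i + T / real N" for i
    by (simp add: t_def algebra_simps add_divide_distrib)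
  have e: "e i = of_bool (t i < \<tau> \<and> \<tau> \<le> t (Suc i))" for i
    using \<tau> T N t_Suc[of i] by (auto simp: e_def indicator_def) (smt (verit) divide_pos_pos of_nat_0_less_iff)
  have "(\<Sum>i<N. e i) = indicator {0..t N} \<tau> - indicator {0..t 0} \<tau>"
    unfolding e_def by (rule sum_lessThan_telescope)
  also have "\<dots> = 1"
    using \<tau> N by (simp add: t_def indicator_def)
  finally have sum_e: "(\<Sum>i<N. e i) = 1" .
  have "\<psi> \<tau> = (\<Sum>i<N. \<psi> \<tau> * e i)"
    by (simp add: sum_e flip: sum_distrib_left)
  then have "riemann_sum \<psi> T (\<lambda>t. indicator {0..t} \<tau>) N - \<psi> \<tau> = (\<Sum>i<N. (\<psi> (t i) - \<psi> \<tau>) * e i)"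
    by (simp add: riemann_sum_def e_def t_def left_diff_distrib sum_subtractf)
  also have "\<bar>\<dots>\<bar> \<le> (\<Sum>i<N. L * (T / real N) * e i)"
  proof (rule order_trans[OF sum_abs], rule sum_mono)
    fix i assume "i \<in> {..<N}"
    then have ti: "t i \<in> {0..T}"
      unfolding t_def using T by (intro grid_mem) auto
    show "\<bar>(\<psi> (t i) - \<psi> \<tau>) * e i\<bar> \<le> L * (T / real N) * e i"
    proof (cases "t i < \<tau> \<and> \<tau> \<le> t (Suc i)")
      case True
      have "\<bar>\<psi> (t i) - \<psi> \<tau>\<bar> \<le> L * \<bar>t i - \<tau>\<bar>"
        using lipschitz_onD[OF lip ti, of \<tau>] \<tau> by (simp add: dist_real_def)
      also have "\<dots> \<le> L * (T / real N)"
        using True t_Suc[of i] lipschitz_on_nonneg[OF lip] by (intro mult_left_mono) auto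
      finally show ?thesis
        using True by (simp add: e)
    qed (auto simp: e)
  qed
  also have "\<dots> = L * (T / real N)"
    unfolding sum_distrib_left[symmetric] sum_e by simp
  finally show ?thesis .
qed

lemma riemann_step_tendsto:
  assumes T: "0 < T" and lip: "L-lipschitz_on {0..T} \<psi>"
  shows "l2_tendsto (lebesgue_on {0..T}) (\<lambda>n \<tau>. riemann_sum \<psi> T (\<lambda>t. indicator {0..t} \<tau>) (2 ^ n)) \<psi>"
  unfolding l2_tendsto_def
proof (rule Lim_null_comparison)
  let ?L = "lebesgue_on {0..T}"
  have L: "0 \<le> L"
    using lip by (rule lipschitz_on_nonneg)
  have \<psi>: "\<psi> \<in> L2 ?L"
    using lipschitz_on_continuous_on[OF lip] by (rule continuous_L2)
  have bound: "l2_norm ?L (\<lambda>\<tau>. riemann_sum \<psi> T (\<lambda>t. indicator {0..t} \<tau>) N - \<psi> \<tau>)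
      \<le> L * (T / real N) * sqrt (measure ?L (space ?L))" if "0 < N" for N
  proof (rule l2_norm_le_bound[OF finite_measure_lebesgue_on_Icc])
    obtain J c where "step_function J c = (\<lambda>\<tau>. riemann_sum \<psi> T (\<lambda>t. indicator {0..t} \<tau>) N)"
      using riemann_sum_as_step[of T \<psi> N] T by (metis less_imp_le)
    then have "(\<lambda>\<tau>. riemann_sum \<psi> T (\<lambda>t. indicator {0..t} \<tau>) N) \<in> L2 ?L"
      by (metis step_function_L2)
    then show "(\<lambda>\<tau>. riemann_sum \<psi> T (\<lambda>t. indicator {0..t} \<tau>) N - \<psi> \<tau>) \<in> borel_measurable ?L"
      using \<psi> by (intro L2_measurable L2_diff)
    \<comment> \<open>The exceptional point 0 of the pointwise estimate is a null set.\<close>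
    have "AE \<tau> in lebesgue. \<tau> \<noteq> (0::real)"
      by (intro AE_completion AE_lborel_singleton)
    then show "AE \<tau> in ?L. \<bar>riemann_sum \<psi> T (\<lambda>t. indicator {0..t} \<tau>) N - \<psi> \<tau>\<bar> \<le> L * (T / real N)"
      by (subst AE_restrict_space_iff)
        (auto elim!: eventually_mono intro!: riemann_step_close T lip that
          simp del: times_divide_eq_right)
  qed (use T L in auto)
  have "norm (l2_norm ?L (\<lambda>\<tau>. riemann_sum \<psi> T (\<lambda>t. indicator {0..t} \<tau>) (2 ^ n) - \<psi> \<tau>))
      \<le> L * (T / real (2 ^ n)) * sqrt (measure ?L (space ?L))" for n
    unfolding real_norm_def abs_of_nonneg[OF l2_norm_nonneg] by (rule bound) simp
  then show "\<forall>\<^sub>F n in sequentially.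
      norm (l2_norm ?L (\<lambda>\<tau>. riemann_sum \<psi> T (\<lambda>t. indicator {0..t} \<tau>) (2 ^ n) - \<psi> \<tau>))
      \<le> L * (T / real (2 ^ n)) * sqrt (measure ?L (space ?L))"
    by (intro always_eventually allI)
  have "(\<lambda>n. L * (T / 2 ^ n) * sqrt (measure ?L (space ?L))) \<longlonglongrightarrow> L * 0 * sqrt (measure ?L (space ?L))"
    by (intro tendsto_mult tendsto_const LIMSEQ_divide_realpow_zero) simp
  then show "(\<lambda>n. L * (T / real (2 ^ n)) * sqrt (measure ?L (space ?L))) \<longlonglongrightarrow> 0"
    by simp
qed

text \<open>Halving a cell changes only the coefficient on its right half, from the value at the
  left end to the value at the midpoint.\<close>

lemma riemann_sum_refine:
  "riemann_sum \<psi> T G (2 * N) - riemann_sum \<psi> T G N =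
     (\<Sum>i<N. (\<psi> (real (2 * i + 1) * (T / real (2 * N))) - \<psi> (real (2 * i) * (T / real (2 * N)))) *
       (G (real (2 * i + 2) * (T / real (2 * N))) - G (real (2 * i + 1) * (T / real (2 * N)))))"
proof -
  let ?h = "T / real (2 * N)"
  define f where "f i = \<psi> (real i * ?h) * (G (real (Suc i) * ?h) - G (real i * ?h))" for i
  have "(\<Sum>i<2 * N. f i) = (\<Sum>i<N. f (2 * i) + f (2 * i + 1))"
    using sum.nat_group[of f 2 N] by (simp add: mult.commute numeral_2_eq_2)
  then have 1: "riemann_sum \<psi> T G (2 * N) = (\<Sum>i<N. f (2 * i) + f (2 * i + 1))"
    by (simp add: riemann_sum_def f_def)
  have "real i * (T / real N) = real (2 * i) * ?h" "real (Suc i) * (T / real N) = real (2 * i + 2) * ?h" for i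
    by (simp_all add: algebra_simps add_divide_distrib)
  then have 2: "riemann_sum \<psi> T G N =
      (\<Sum>i<N. \<psi> (real (2 * i) * ?h) * (G (real (2 * i + 2) * ?h) - G (real (2 * i) * ?h)))"
    unfolding riemann_sum_def by presburger
  show ?thesis
    unfolding 1 2 sum_subtractf[symmetric]
  proof (rule sum.cong[OF refl])
    fix i
    have "Suc (2 * i) = 2 * i + 1" "Suc (2 * i + 1) = 2 * i + 2"
      by auto
    then show "f (2 * i) + f (2 * i + 1) - \<psi> (real (2 * i) * ?h) * (G (real (2 * i + 2) * ?h) - G (real (2 * i) * ?h))
        = (\<psi> (real (2 * i + 1) * ?h) - \<psi> (real (2 * i) * ?h)) * (G (real (2 * i + 2) * ?h) - G (real (2 * i + 1) * ?h))"
      unfolding f_def by (simp only: algebra_simps)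
  qed
qed

section \<open>Existence through dyadic Riemann sums\<close>

context fbm
begin

lemma riemann_integral_L2:
  assumes "0 \<le> T"
  shows "(\<lambda>\<omega>. riemann_sum \<psi> T (\<lambda>t. B t \<omega>) N) \<in> L2 M"
  unfolding riemann_sum_def using assms by (intro L2_sum L2_cmult L2_diff B_L2) auto

text \<open>The triangle inequality suffices: there are \<open>N\<close> terms, each with
  coefficient at most \<open>L * ?h\<close> and increment of norm \<open>?h powr H\<close>, and
  \<open>N * ?h = T / 2\<close>. The remaining factor 1/2 is given away.\<close>

lemma norm_riemann_refine:
  assumes T: "0 < T" and lip: "L-lipschitz_on {0..T} \<psi>" and N: "0 < N"
  shows "l2_norm M (\<lambda>\<omega>. riemann_sum \<psi> T (\<lambda>t. B t \<omega>) (2 * N) - riemann_sum \<psi> T (\<lambda>t. B t \<omega>) N)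
    \<le> L * T * (T / real (2 * N)) powr H"
proof -
  let ?h = "T / real (2 * N)"
  have h: "0 < ?h"
    using T N by simp
  define a where "a i = \<psi> (real (2 * i + 1) * ?h) - \<psi> (real (2 * i) * ?h)" for i
  define d where "d i \<omega> = B (real (2 * i + 2) * ?h) \<omega> - B (real (2 * i + 1) * ?h) \<omega>" for i \<omega>
  have d: "d i \<in> L2 M" for i
    unfolding d_def[abs_def] using T by (intro L2_diff B_L2) auto
  have norm_d: "l2_norm M (d i) = ?h powr H" for i
  proof -
    have "real (2 * i + 2) * h - real (2 * i + 1) * h = h" for h :: real
      by (simp add: algebra_simps)
    note this[of ?h]
    then show ?thesis
      unfolding d_def[abs_def] using norm_increment[of "real (2 * i + 1) * ?h" "real (2 * i + 2) * ?h"] h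
      by (simp only: abs_of_pos) (simp add: T less_imp_le)
  qed
  have a: "\<bar>a i\<bar> \<le> L * ?h" if "i < N" for i
  proof -
    have "real (2 * i + 1) * ?h \<in> {0..T}" "real (2 * i) * ?h \<in> {0..T}"
      using that T by (auto simp only: intro!: grid_mem)
    then have "\<bar>a i\<bar> \<le> L * \<bar>real (2 * i + 1) * ?h - real (2 * i) * ?h\<bar>"
      using lipschitz_onD[OF lip] unfolding a_def by (simp only: dist_real_def)
    also have "real (2 * i + 1) * h - real (2 * i) * h = h" for h :: real
      by (simp add: algebra_simps)
    finally show ?thesis
      using h by (simp only: abs_of_pos)
  qed
  have "l2_norm M (\<lambda>\<omega>. riemann_sum \<psi> T (\<lambda>t. B t \<omega>) (2 * N) - riemann_sum \<psi> T (\<lambda>t. B t \<omega>) N)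
      = l2_norm M (\<lambda>\<omega>. \<Sum>i<N. a i * d i \<omega>)"
    by (simp only: riemann_sum_refine a_def d_def)
  also have "\<dots> \<le> (\<Sum>i<N. l2_norm M (\<lambda>\<omega>. a i * d i \<omega>))"
    by (intro l2_norm_sum L2_cmult d)
  also have "\<dots> \<le> (\<Sum>i<N. L * ?h * ?h powr H)"
    unfolding l2_norm_cmult norm_d using a by (intro sum_mono mult_right_mono) auto
  also have "\<dots> = (L * T * ?h powr H) / 2"
    using N by simp
  also have "\<dots> \<le> L * T * ?h powr H"
    using lipschitz_on_nonneg[OF lip] T by simp
  finally show ?thesis .
qed

text \<open>Successive dyadic distances are dominated by a geometric series of ratio
  \<open>(1 / 2) powr H\<close>, so completeness applies. The second conclusion keeps the
  approximating sums explicit, so that bounds on them can be carried over to the integral.\<close>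

lemma wiener_integral_exists:
  assumes T: "0 < T" and lip: "L-lipschitz_on {0..T} \<psi>"
  obtains X where "is_wiener_integral M B T \<psi> X"
    "l2_tendsto M (\<lambda>n \<omega>. riemann_sum \<psi> T (\<lambda>t. B t \<omega>) (2 ^ n)) X"
proof -
  define q where "q = (1 / 2 :: real) powr H"
  have q: "0 < q" "q < 1"
    using H_pos powr_less_mono'[of "1/2" 0 H] by (auto simp: q_def)
  have L: "0 \<le> L"
    using lip by (rule lipschitz_on_nonneg)
  have "summable (\<lambda>n. l2_norm M (\<lambda>\<omega>. riemann_sum \<psi> T (\<lambda>t. B t \<omega>) (2 ^ Suc n)
      - riemann_sum \<psi> T (\<lambda>t. B t \<omega>) (2 ^ n)))"
  proof (rule summable_comparison_test')
    show "summable (\<lambda>n. L * T * T powr H * q ^ Suc n)"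
      using q by (intro summable_mult) (simp add: summable_Suc_iff)
    fix n :: nat
    have "(T / real (2 * 2 ^ n)) powr H = T powr H * ((1 / 2) ^ Suc n) powr H"
      using T by (simp add: powr_mult[symmetric] power_one_over field_simps)
    also have "((1 / 2 :: real) ^ Suc n) powr H = q ^ Suc n"
      unfolding q_def by (simp add: powr_powr powr_realpow[symmetric] mult.commute del: power_Suc)
    finally show "norm (l2_norm M (\<lambda>\<omega>. riemann_sum \<psi> T (\<lambda>t. B t \<omega>) (2 ^ Suc n)
        - riemann_sum \<psi> T (\<lambda>t. B t \<omega>) (2 ^ n))) \<le> L * T * T powr H * q ^ Suc n"
      using norm_riemann_refine[OF T lip, of "2 ^ n"] by (simp add: mult.assoc)
  qed
  then obtain X where X: "X \<in> L2 M"
    and lim: "l2_tendsto M (\<lambda>n \<omega>. riemann_sum \<psi> T (\<lambda>t. B t \<omega>) (2 ^ n)) X"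
    using T by (elim L2_complete[rotated]) (auto intro: riemann_integral_L2)
  have "\<exists>J c. finite J \<and> J \<subseteq> {0..T} \<and>
      step_function J c = (\<lambda>\<tau>. riemann_sum \<psi> T (\<lambda>t. indicator {0..t} \<tau>) (2 ^ n)) \<and>
      step_integral B J c = (\<lambda>\<omega>. riemann_sum \<psi> T (\<lambda>t. B t \<omega>) (2 ^ n))" for n :: nat
    using riemann_sum_as_step[of T \<psi> "2 ^ n" B] T by (metis less_imp_le)
  then obtain J c where "\<And>n. finite (J n)" "\<And>n. J n \<subseteq> {0..T}"
      "\<And>n. step_function (J n) (c n) = (\<lambda>\<tau>. riemann_sum \<psi> T (\<lambda>t. indicator {0..t} \<tau>) (2 ^ n))"
      "\<And>n. step_integral B (J n) (c n) = (\<lambda>\<omega>. riemann_sum \<psi> T (\<lambda>t. B t \<omega>) (2 ^ n))"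
    by metis
  then have "is_wiener_integral M B T \<psi> X"
    unfolding is_wiener_integral_def
    using X lim riemann_step_tendsto[OF T lip] continuous_L2[OF lipschitz_on_continuous_on[OF lip]]
    by (intro conjI exI[of _ J] exI[of _ c]) auto
  with lim show ?thesis
    using that by blast
qed

section \<open>Scaling and mean of the Wiener integral\<close>

lemma is_wiener_integral_some:
  "is_wiener_integral M B T \<psi> X \<Longrightarrow> is_wiener_integral M B T \<psi> (wiener_integral M B T \<psi>)"
  unfolding wiener_integral_def by (rule someI[where P = "is_wiener_integral M B T \<psi>"])

lemma is_wiener_integral_cmult:
  assumes "is_wiener_integral M B T \<psi> X"
  shows "is_wiener_integral M B T (\<lambda>\<tau>. k * \<psi> \<tau>) (\<lambda>\<omega>. k * X \<omega>)"
proof -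
  have scale: "l2_tendsto N (\<lambda>n x. k * fs n x) (\<lambda>x. k * f x)" if "l2_tendsto N fs f"
    for N :: "'y measure" and fs and f :: "'y \<Rightarrow> real"
    using tendsto_mult_right_zero[OF that[unfolded l2_tendsto_def], of "\<bar>k\<bar>"]
    by (simp add: l2_tendsto_def l2_norm_cmult flip: right_diff_distrib)
  obtain J c where J: "\<And>n. finite (J n) \<and> J n \<subseteq> {0..T}"
    and s: "l2_tendsto (lebesgue_on {0..T}) (\<lambda>n. step_function (J n) (c n)) \<psi>"
    and I: "l2_tendsto M (\<lambda>n. step_integral B (J n) (c n)) X"
    using assms by (auto simp: is_wiener_integral_def)
  have "step_function (J n) (\<lambda>t. k * c n t) = (\<lambda>\<tau>. k * step_function (J n) (c n) \<tau>)"
    "step_integral B (J n) (\<lambda>t. k * c n t) = (\<lambda>\<omega>. k * step_integral B (J n) (c n) \<omega>)" for n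
    by (auto simp: step_function_def step_integral_def sum_distrib_left mult.assoc)
  then show ?thesis
    using assms J scale[OF s] scale[OF I] unfolding is_wiener_integral_def
    by (intro conjI L2_cmult exI[of _ J] exI[of _ "\<lambda>n t. k * c n t"]) auto
qed

lemma mean_wiener_integral:
  assumes "is_wiener_integral M B T \<psi> X"
  shows "(\<integral>\<omega>. X \<omega> \<partial>M) = 0"
proof -
  obtain J c where J: "\<And>n. J n \<subseteq> {0..T}" and X: "X \<in> L2 M"
    and I: "l2_tendsto M (\<lambda>n. step_integral B (J n) (c n)) X"
    using assms by (auto simp: is_wiener_integral_def)
  have J0: "J n \<subseteq> {0..}" for n
    using J[of n] by auto
  have "(\<lambda>n. l2_inner M (step_integral B (J n) (c n)) (\<lambda>\<omega>. 1)) \<longlonglongrightarrow> l2_inner M X (\<lambda>\<omega>. 1)"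
    by (intro l2_inner_tendsto step_integral_L2 J0 X const_L2 I)
  then show ?thesis
    using mean_step_integral[OF J0] by (simp add: LIMSEQ_const_iff l2_inner_real)
qed

end

section \<open>Second moments of Wiener integrals\<close>

text \<open>The indices on either side of \<open>i\<close> are mapped injectively to their distances
  in \<open>{1..N}\<close>, so each side is at most the one-sided sum.\<close>

lemma sum_abs_diff_powr_neg_le:
  fixes p :: real
  assumes p: "0 < p" "p < 1" and i: "i < N"
  shows "(\<Sum>j<N. \<bar>real i - real j\<bar> powr - p) \<le> 2 * real N powr (1 - p) / (1 - p)"
proof -
  have le: "(\<Sum>j\<in>S. \<bar>real i - real j\<bar> powr - p) \<le> (\<Sum>m=1..N. real m powr - p)"
    if "inj_on g S" "g ` S \<subseteq> {1..N}" "\<And>j. j \<in> S \<Longrightarrow> \<bar>real i - real j\<bar> = real (g j)" for g :: "nat \<Rightarrow> nat" and S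
  proof -
    have "(\<Sum>j\<in>S. \<bar>real i - real j\<bar> powr - p) = (\<Sum>m\<in>g ` S. real m powr - p)"
      using that by (simp add: sum.reindex)
    also have "\<dots> \<le> (\<Sum>m=1..N. real m powr - p)"
      using that by (intro sum_mono2) auto
    finally show ?thesis .
  qed
  have "(\<Sum>j<N. \<bar>real i - real j\<bar> powr - p)
      = (\<Sum>j\<in>{0..<i}. \<bar>real i - real j\<bar> powr - p) + (\<Sum>j\<in>{i..<N}. \<bar>real i - real j\<bar> powr - p)"
    using i by (subst sum.atLeastLessThan_concat) (auto simp: atLeast0LessThan)
  \<comment> \<open>The term \<open>j = i\<close> drops out because
    \<open>0 powr - p = 0\<close>.\<close>
  also have "\<dots> = (\<Sum>j\<in>{0..<i}. \<bar>real i - real j\<bar> powr - p)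
      + (\<Sum>j\<in>{Suc i..<N}. \<bar>real i - real j\<bar> powr - p)"
    using i by (simp add: sum.atLeast_Suc_lessThan)
  also have "\<dots> \<le> (\<Sum>m=1..N. real m powr - p) + (\<Sum>m=1..N. real m powr - p)"
    using i by (intro add_mono le[where g = "\<lambda>j. i - j"] le[where g = "\<lambda>j. j - i"])
      (auto simp: inj_on_def of_nat_diff)
  also have "\<dots> \<le> 2 * (real N powr (1 - p) / (1 - p))"
    using sum_powr_neg_le[OF p, of N] by simp
  finally show ?thesis
    by simp
qed

lemma square_le_powr_interpolate:
  fixes x a b p :: real
  assumes x: "0 \<le> x" "x \<le> a" "x \<le> b" and p: "0 < p" "p < 1"
  shows "x\<^sup>2 \<le> a powr (2 * p) * b powr (2 - 2 * p)"
proof -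
  have "x\<^sup>2 = x powr (2 * p) * x powr (2 - 2 * p)"
    using x(1) by (cases "x = 0") (simp_all flip: powr_add add: powr_numeral)
  also have "\<dots> \<le> a powr (2 * p) * b powr (2 - 2 * p)"
    using x p by (intro mult_mono powr_mono2) auto
  finally show ?thesis .
qed

context fbm
begin

lemma second_moment_increments:
  fixes a t :: "nat \<Rightarrow> real" and A :: real
  defines "d \<equiv> \<lambda>i \<omega>. B (t (Suc i)) \<omega> - B (t i) \<omega>"
  assumes t0: "t 0 = 0" and t: "\<And>i. t i \<le> t (Suc i)" and A: "\<And>i. i < N \<Longrightarrow> \<bar>a i\<bar> \<le> A"
  shows "(l2_norm M (\<lambda>\<omega>. \<Sum>i<N. a i * d i \<omega>))\<^sup>2
    \<le> A\<^sup>2 * t N powr (2 * H) + (\<Sum>i<N. \<Sum>j<N. (a i - a j)\<^sup>2 * - l2_inner M (d i) (d j)) / 2"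
proof -
  define c where "c i j = l2_inner M (d i) (d j)" for i j
  have inc: "incseq t"
    using t by (rule incseq_SucI)
  have t_nonneg: "0 \<le> t i" for i
    using incseqD[OF inc, of 0 i] t0 by simp
  have d: "d i \<in> L2 M" for i
    unfolding d_def using t_nonneg by (intro L2_diff B_L2)
  define E where "E = (\<lambda>\<omega>. B (t N) \<omega> - B (t 0) \<omega>)"
  have E: "(\<lambda>\<omega>. \<Sum>j<N. d j \<omega>) = E"
    unfolding d_def E_def by (rule ext, rule sum_lessThan_telescope)
  have sum_right: "l2_inner M Y (\<lambda>\<omega>. \<Sum>j<N. b j * d j \<omega>) = (\<Sum>j<N. b j * l2_inner M Y (d j))"
    if "Y \<in> L2 M" for Y b
  proof -
    have "l2_inner M (\<lambda>\<omega>. \<Sum>j<N. b j * d j \<omega>) Y = (\<Sum>j<N. l2_inner M (\<lambda>\<omega>. b j * d j \<omega>) Y)"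
      by (intro l2_inner_sum_left L2_cmult d that)
    then show ?thesis
      by (simp add: l2_inner_cmult_left l2_inner_commute[of M Y])
  qed
  have row: "(\<Sum>j<N. c i j) = l2_inner M (d i) E" for i
    using sum_right[OF d, of i "\<lambda>_. 1"] by (simp add: E c_def)
  \<comment> \<open>The row sum telescopes to the covariance of an increment with
    \<open>B (t N)\<close>, and \<open>R s (t N)\<close> is nondecreasing in \<open>s\<close> up to
    \<open>t N\<close>.\<close>
  have row_nonneg: "0 \<le> (\<Sum>j<N. c i j)" if "i < N" for i
  proof -
    have "t (Suc i) \<le> t N"
      using incseqD[OF inc, of "Suc i" N] that by simp
    then have "t i powr (2 * H) \<le> t (Suc i) powr (2 * H)"
      "\<bar>t (Suc i) - t N\<bar> powr (2 * H) \<le> \<bar>t i - t N\<bar> powr (2 * H)"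
      using t[of i] t_nonneg[of i] H_pos by (auto intro!: powr_mono2)
    moreover have "l2_inner M (d i) E = R (t (Suc i)) (t N) - R (t i) (t N)"
      unfolding d_def E_def using t_nonneg by (simp add: inner_increments t0)
    ultimately show ?thesis
      unfolding row by (simp add: R_def)
  qed
  have total: "(\<Sum>i<N. \<Sum>j<N. c i j) = t N powr (2 * H)"
  proof -
    have "(\<Sum>i<N. \<Sum>j<N. c i j) = (\<Sum>i<N. 1 * l2_inner M E (d i))"
      unfolding row by (simp add: l2_inner_commute)
    also have "\<dots> = l2_inner M E E"
      using sum_right[of E "\<lambda>_. 1"] t_nonneg by (simp add: E) (simp add: E_def L2_diff B_L2)
    also have "\<dots> = t N powr (2 * H)"
      unfolding E_def using t_nonneg by (simp add: inner_increments t0) (simp add: R_def t_nonneg)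
    finally show ?thesis .
  qed
  have "(l2_norm M (\<lambda>\<omega>. \<Sum>i<N. a i * d i \<omega>))\<^sup>2 = (\<Sum>i<N. \<Sum>j<N. a i * a j * c i j)"
  proof -
    have "(\<lambda>\<omega>. \<Sum>i<N. a i * d i \<omega>) \<in> L2 M"
      by (intro L2_sum L2_cmult d)
    then have "(l2_norm M (\<lambda>\<omega>. \<Sum>i<N. a i * d i \<omega>))\<^sup>2
        = (\<Sum>i<N. a i * l2_inner M (d i) (\<lambda>\<omega>. \<Sum>i<N. a i * d i \<omega>))"
      unfolding l2_norm_sq by (subst sum_right) (simp_all add: l2_inner_commute)
    then show ?thesis
      by (simp add: sum_right d c_def sum_distrib_left mult_ac)
  qed
  also have "\<dots> = (\<Sum>i<N. (a i)\<^sup>2 * (\<Sum>j<N. c i j)) + (\<Sum>i<N. \<Sum>j<N. (a i - a j)\<^sup>2 * - c i j) / 2"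
  proof -
    have "(\<Sum>i<N. \<Sum>j<N. (a j)\<^sup>2 * c i j) = (\<Sum>j<N. \<Sum>i<N. (a j)\<^sup>2 * c i j)"
      by (rule sum.swap)
    also have "\<dots> = (\<Sum>i<N. \<Sum>j<N. (a i)\<^sup>2 * c i j)"
      by (simp add: c_def l2_inner_commute)
    finally have swap: "(\<Sum>i<N. \<Sum>j<N. (a j)\<^sup>2 * c i j) = (\<Sum>i<N. \<Sum>j<N. (a i)\<^sup>2 * c i j)" .
    \<comment> \<open>Polarisation of the product \<open>a i * a j\<close>; the two square terms
      then agree after summation because \<open>c\<close> is symmetric.\<close>
    have "a i * a j * c i j
        = (a i)\<^sup>2 * c i j / 2 + (a j)\<^sup>2 * c i j / 2 + (a i - a j)\<^sup>2 * - c i j / 2" for i j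
      by (simp add: power2_eq_square algebra_simps add_divide_distrib diff_divide_distrib)
    then have "(\<Sum>i<N. \<Sum>j<N. a i * a j * c i j)
        = (\<Sum>i<N. \<Sum>j<N. (a i)\<^sup>2 * c i j) / 2 + (\<Sum>i<N. \<Sum>j<N. (a j)\<^sup>2 * c i j) / 2
          + (\<Sum>i<N. \<Sum>j<N. (a i - a j)\<^sup>2 * - c i j) / 2"
      by (simp only: sum.distrib sum_divide_distrib)
    then show ?thesis
      by (simp add: swap sum_distrib_left)
  qed
  also have "(\<Sum>i<N. (a i)\<^sup>2 * (\<Sum>j<N. c i j)) \<le> (\<Sum>i<N. A\<^sup>2 * (\<Sum>j<N. c i j))"
  proof (intro sum_mono mult_right_mono row_nonneg)
    show "(a i)\<^sup>2 \<le> A\<^sup>2" if "i \<in> {..<N}" for i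
      using A[of i] that by (simp add: abs_le_square_iff[symmetric])
  qed simp
  also have "\<dots> = A\<^sup>2 * t N powr (2 * H)"
    by (simp add: total flip: sum_distrib_left)
  finally show ?thesis
    by (simp add: c_def)
qed

text \<open>Stationary increments and self-similarity: the covariance depends on the index distance
  only, and the mesh scales out, leaving half a second central difference of the power
  \<open>2 * H\<close>. The absolute value around \<open>\<bar>real i - real j\<bar> - 1\<close>
  lets the formula include the diagonal.\<close>

lemma inner_grid_increments:
  assumes h: "0 \<le> h"
  shows "l2_inner M (\<lambda>\<omega>. B (real (Suc i) * h) \<omega> - B (real i * h) \<omega>)
      (\<lambda>\<omega>. B (real (Suc j) * h) \<omega> - B (real j * h) \<omega>)
    = h powr (2 * H) / 2 * ((\<bar>real i - real j\<bar> + 1) powr (2 * H)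
      + \<bar>\<bar>real i - real j\<bar> - 1\<bar> powr (2 * H) - 2 * \<bar>real i - real j\<bar> powr (2 * H))"
proof -
  have pull: "\<bar>x * h - y * h\<bar> powr (2 * H) = h powr (2 * H) * \<bar>x - y\<bar> powr (2 * H)" for x y
  proof -
    have "\<bar>x * h - y * h\<bar> = h * \<bar>x - y\<bar>"
      using h by (simp add: abs_mult flip: left_diff_distrib)
    then show ?thesis
      using h by (simp add: powr_mult)
  qed
  have sym: "\<bar>x + 1\<bar> powr (2 * H) + \<bar>x - 1\<bar> powr (2 * H)
      = (\<bar>x\<bar> + 1) powr (2 * H) + \<bar>\<bar>x\<bar> - 1\<bar> powr (2 * H)" for x :: real
    by (cases "0 \<le> x") (auto simp: abs_minus_commute add.commute)
  have "l2_inner M (\<lambda>\<omega>. B (real (Suc i) * h) \<omega> - B (real i * h) \<omega>)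
      (\<lambda>\<omega>. B (real (Suc j) * h) \<omega> - B (real j * h) \<omega>)
      = (\<bar>real (Suc i) * h - real j * h\<bar> powr (2 * H) + \<bar>real i * h - real (Suc j) * h\<bar> powr (2 * H)
        - \<bar>real (Suc i) * h - real (Suc j) * h\<bar> powr (2 * H) - \<bar>real i * h - real j * h\<bar> powr (2 * H)) / 2"
    using h by (subst inner_increments) (auto simp: R_def diff_divide_distrib add_divide_distrib)
  also have "\<dots> = h powr (2 * H) / 2 * ((\<bar>(real i - real j) + 1\<bar> powr (2 * H)
      + \<bar>(real i - real j) - 1\<bar> powr (2 * H)) - 2 * \<bar>real i - real j\<bar> powr (2 * H))"
    unfolding pull by (simp add: algebra_simps add_divide_distrib diff_divide_distrib)
  finally show ?thesis
    unfolding sym .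
qed

lemma riemann_second_moment:
  assumes T: "0 < T" and N: "0 < N" and lip: "L-lipschitz_on {0..T} \<psi>"
    and A: "\<And>\<tau>. \<tau> \<in> {0..T} \<Longrightarrow> \<bar>\<psi> \<tau>\<bar> \<le> A"
  shows "(l2_norm M (\<lambda>\<omega>. riemann_sum \<psi> T (\<lambda>t. B t \<omega>) N))\<^sup>2 \<le> A\<^sup>2 * T powr (2 * H) +
    (if H < 1 / 2 then (2 * A) powr (4 * H) * L powr (2 - 4 * H) * T powr (2 - 2 * H) / (1 - 2 * H) else 0)"
proof -
  define h where "h = T / real N"
  have h: "0 < h"
    using T N by (simp add: h_def)
  define a where "a i = \<psi> (real i * h)" for i
  define d where "d i \<omega> = B (real (Suc i) * h) \<omega> - B (real i * h) \<omega>" for i \<omega>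
  have grid: "real i * h \<in> {0..T}" if "i < N" for i
    unfolding h_def using T that by (intro grid_mem) auto
  have L: "0 \<le> L"
    using lip by (rule lipschitz_on_nonneg)
  have "(l2_norm M (\<lambda>\<omega>. riemann_sum \<psi> T (\<lambda>t. B t \<omega>) N))\<^sup>2
      = (l2_norm M (\<lambda>\<omega>. \<Sum>i<N. a i * d i \<omega>))\<^sup>2"
    by (simp add: riemann_sum_def a_def d_def h_def)
  also have "\<dots> \<le> A\<^sup>2 * (real N * h) powr (2 * H)
      + (\<Sum>i<N. \<Sum>j<N. (a i - a j)\<^sup>2 * - l2_inner M (d i) (d j)) / 2"
    unfolding d_def[abs_def] using h A grid
    by (intro second_moment_increments) (auto simp: a_def distrib_right)
  also have "real N * h = T"
    using N by (simp add: h_def)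
  also have "(\<Sum>i<N. \<Sum>j<N. (a i - a j)\<^sup>2 * - l2_inner M (d i) (d j)) / 2 \<le>
    (if H < 1 / 2 then (2 * A) powr (4 * H) * L powr (2 - 4 * H) * T powr (2 - 2 * H) / (1 - 2 * H) else 0)"
  proof (cases "H < 1 / 2")
    case False
    \<comment> \<open>On the diagonal the square vanishes; off it the covariance is nonnegative by
      convexity.\<close>
    have "(a i - a j)\<^sup>2 * - l2_inner M (d i) (d j) \<le> 0" for i j
    proof (cases "i = j")
      case False
      then have m: "1 \<le> \<bar>real i - real j\<bar>"
        by linarith
      have "0 \<le> l2_inner M (d i) (d j)"
        unfolding d_def[abs_def] inner_grid_increments[OF less_imp_le[OF h]]
        using powr_second_difference_nonneg[OF m, of "2 * H"] \<open>\<not> H < 1 / 2\<close> m by simp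
      then show ?thesis
        by simp
    qed simp
    then have "(\<Sum>i<N. \<Sum>j<N. (a i - a j)\<^sup>2 * - l2_inner M (d i) (d j)) \<le> 0"
      by (intro sum_nonpos)
    with False show ?thesis
      by simp
  next
    case True
    define p where "p = 2 * H"
    have p: "0 < p" "p < 1"
      using True H_pos by (auto simp: p_def)
    \<comment> \<open>The mesh exponent is \<open>2 - 2 * p\<close> from the Lipschitz bound plus
      \<open>p\<close> from the covariance. The index distance has exponents
      \<open>2 - 2 * p\<close> and \<open>p - 2\<close>, whose sum is \<open>- p\<close>.\<close>
    define K where "K = (2 * A) powr (2 * p) * L powr (2 - 2 * p) * h powr (2 - p)"
    have term_le: "(a i - a j)\<^sup>2 * - l2_inner M (d i) (d j) \<le> K * \<bar>real i - real j\<bar> powr - p"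
      if ij: "i < N" "j < N" for i j
    proof (cases "i = j")
      case False
      define m where "m = \<bar>real i - real j\<bar>"
      have m: "1 \<le> m"
        using False unfolding m_def by linarith
      have "\<bar>a i - a j\<bar> \<le> 2 * A"
        using A[OF grid[OF ij(1)]] A[OF grid[OF ij(2)]] by (simp add: a_def)
      moreover have "\<bar>a i - a j\<bar> \<le> L * h * m"
      proof -
        have "\<bar>a i - a j\<bar> \<le> L * \<bar>real i * h - real j * h\<bar>"
          using lipschitz_onD[OF lip grid[OF ij(1)] grid[OF ij(2)]] by (simp add: a_def dist_real_def)
        also have "\<bar>real i * h - real j * h\<bar> = h * m"
          using h by (simp add: m_def abs_mult flip: left_diff_distrib)
        finally show ?thesis
          by (simp add: mult.assoc)
      qed
      ultimately have "\<bar>a i - a j\<bar>\<^sup>2 \<le> (2 * A) powr (2 * p) * (L * h * m) powr (2 - 2 * p)"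
        using p by (intro square_le_powr_interpolate) auto
      then have "(a i - a j)\<^sup>2 \<le> (2 * A) powr (2 * p) * (L powr (2 - 2 * p) * h powr (2 - 2 * p) * m powr (2 - 2 * p))"
        using L h m by (simp add: powr_mult)
      moreover have "- l2_inner M (d i) (d j) \<le> h powr p * m powr (p - 2)"
      proof -
        have "- l2_inner M (d i) (d j)
            = h powr p / 2 * (2 * m powr p - (m + 1) powr p - (m - 1) powr p)"
          unfolding d_def[abs_def] inner_grid_increments[OF less_imp_le[OF h]] m_def[symmetric] p_def[symmetric]
          using m by (simp add: algebra_simps)
        also have "\<dots> \<le> h powr p / 2 * (2 * m powr (p - 2))"
          using powr_second_difference_ge[OF m, of p] p by (intro mult_left_mono) auto
        finally show ?thesis
          by simp
      qed
      ultimately have "(a i - a j)\<^sup>2 * - l2_inner M (d i) (d j)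
          \<le> ((2 * A) powr (2 * p) * (L powr (2 - 2 * p) * h powr (2 - 2 * p) * m powr (2 - 2 * p))) *
            (h powr p * m powr (p - 2))"
        by (meson mult_left_mono mult_right_mono order_trans powr_ge_zero zero_le_mult_iff zero_le_power2)
      also have "\<dots> = (2 * A) powr (2 * p) * L powr (2 - 2 * p) * (h powr (2 - 2 * p) * h powr p) *
          (m powr (2 - 2 * p) * m powr (p - 2))"
        by (simp add: mult_ac)
      also have "\<dots> = K * m powr - p"
        by (simp add: K_def flip: powr_add)
      finally show ?thesis
        by (simp add: m_def)
    qed simp
    have "0 \<le> K"
      by (simp add: K_def)
    have "(\<Sum>i<N. \<Sum>j<N. (a i - a j)\<^sup>2 * - l2_inner M (d i) (d j))
        \<le> (\<Sum>i<N. \<Sum>j<N. K * \<bar>real i - real j\<bar> powr - p)"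
      using term_le by (intro sum_mono) auto
    also have "\<dots> \<le> (\<Sum>i<N. K * (2 * real N powr (1 - p) / (1 - p)))"
      unfolding sum_distrib_left[symmetric] using \<open>0 \<le> K\<close> sum_abs_diff_powr_neg_le[OF p]
      by (intro sum_mono mult_left_mono) auto
    also have "\<dots> = 2 * (K * (real N * real N powr (1 - p))) / (1 - p)"
      by simp
    \<comment> \<open>The double sum grows like \<open>real N powr (2 - p)\<close>, which cancels
      the mesh power exactly; the bound is therefore uniform in \<open>N\<close>.\<close>
    also have "K * (real N * real N powr (1 - p)) = (2 * A) powr (2 * p) * L powr (2 - 2 * p) * T powr (2 - p)"
    proof -
      have "real N * real N powr (1 - p) = real N powr (2 - p)"
        using N by (simp add: powr_mult_base)
      moreover have "h powr (2 - p) * real N powr (2 - p) = T powr (2 - p)"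
        using T N h by (simp add: h_def flip: powr_mult)
      ultimately show ?thesis
        by (simp add: K_def mult.assoc)
    qed
    finally show ?thesis
      using True by (simp add: p_def field_simps)
  qed
  finally show ?thesis
    by simp
qed

text \<open>The bound on Riemann sums is uniform in the mesh, so it survives the dyadic limit
  \<open>Y\<close>; almost sure uniqueness transfers it to any version \<open>X\<close>.\<close>

lemma wiener_integral_second_moment:
  assumes T: "0 < T" and lip: "L-lipschitz_on {0..T} \<psi>"
    and A: "\<And>\<tau>. \<tau> \<in> {0..T} \<Longrightarrow> \<bar>\<psi> \<tau>\<bar> \<le> A"
    and X: "is_wiener_integral M B T \<psi> X"
  shows "(\<integral>\<omega>. (X \<omega>)\<^sup>2 \<partial>M) \<le> A\<^sup>2 * T powr (2 * H) +
    (if H < 1 / 2 then (2 * A) powr (4 * H) * L powr (2 - 4 * H) * T powr (2 - 2 * H) / (1 - 2 * H) else 0)"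
    (is "_ \<le> ?K")
proof -
  obtain Y where Y: "is_wiener_integral M B T \<psi> Y"
    and lim: "l2_tendsto M (\<lambda>n \<omega>. riemann_sum \<psi> T (\<lambda>t. B t \<omega>) (2 ^ n)) Y"
    using wiener_integral_exists[OF T lip] .
  have X2: "X \<in> L2 M" and Y2: "Y \<in> L2 M"
    using X Y by (auto simp: is_wiener_integral_def)
  have "(\<lambda>n. (l2_norm M (\<lambda>\<omega>. riemann_sum \<psi> T (\<lambda>t. B t \<omega>) (2 ^ n)))\<^sup>2) \<longlonglongrightarrow> (l2_norm M Y)\<^sup>2"
    using T by (intro tendsto_power l2_norm_tendsto riemann_integral_L2 Y2 lim) auto
  then have "(l2_norm M Y)\<^sup>2 \<le> ?K"
    by (rule LIMSEQ_le_const2) (use riemann_second_moment[OF T _ lip A] in auto)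
  moreover have "(l2_norm M Y)\<^sup>2 = (\<integral>\<omega>. (Y \<omega>)\<^sup>2 \<partial>M)"
    unfolding l2_norm_sq l2_inner_real by (simp add: power2_eq_square)
  moreover have "(\<integral>\<omega>. (X \<omega>)\<^sup>2 \<partial>M) = (\<integral>\<omega>. (Y \<omega>)\<^sup>2 \<partial>M)"
  proof (rule integral_cong_AE)
    show "AE \<omega> in M. (X \<omega>)\<^sup>2 = (Y \<omega>)\<^sup>2"
      using wiener_integral_unique[OF X Y] by eventually_elim simp
  qed (use X2 Y2 in \<open>auto simp: L2_real_iff\<close>)
  ultimately show ?thesis
    by simp
qed

end

section \<open>The eigenmodes of the wave equation\<close>

text \<open>Division by \<open>w\<close> compensates the frequency, so one Lipschitz constant serves
  all modes and the decay comes from the size of the mode alone.\<close>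

lemma lipschitz_sin_mode:
  assumes "0 < w"
  shows "1-lipschitz_on S (\<lambda>\<tau>::real. sin (w * (T - \<tau>)) / w)"
proof (rule lipschitz_onI)
  fix x y
  have "\<bar>sin (w * (T - x)) - sin (w * (T - y))\<bar>
      = 2 * \<bar>sin ((w * (T - x) - w * (T - y)) / 2)\<bar> * \<bar>cos ((w * (T - x) + w * (T - y)) / 2)\<bar>"
    by (simp add: sin_diff_sin abs_mult)
  also have "\<dots> \<le> 2 * \<bar>(w * (T - x) - w * (T - y)) / 2\<bar> * 1"
    by (intro mult_mono abs_sin_x_le_abs_x) auto
  also have "\<dots> = w * \<bar>x - y\<bar>"
  proof -
    have "w * (T - x) - w * (T - y) = w * (y - x)"
      by (simp add: algebra_simps)
    then show ?thesis
      using assms by (simp add: abs_mult abs_minus_commute)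
  qed
  finally show "dist (sin (w * (T - x)) / w) (sin (w * (T - y)) / w) \<le> 1 * dist x y"
    using assms by (simp add: dist_real_def field_simps flip: diff_divide_distrib)
qed simp

text \<open>By orthonormality all terms but \<open>j = k\<close> are zero, so the infinite sum
  reduces to a single term and no convergence question arises.\<close>

lemma wave_propagator_inner_eigenfunction:
  assumes onb: "orthonormal_basis_L2 (lebesgue_on D) \<phi>" and k: "1 \<le> k"
  shows "wave_propagator_inner D lam \<phi> t w (\<phi> k) =
    l2_inner (lebesgue_on D) w (\<phi> k) * (sin (sqrt (lam k) * t) / sqrt (lam k))"
proof -
  have orth: "l2_inner (lebesgue_on D) (\<phi> k) (\<phi> j) = (if k = j then 1 else 0)" if "1 \<le> j" for j
    using onb k that by (simp add: orthonormal_basis_L2_def)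
  have "wave_propagator_inner D lam \<phi> t w (\<phi> k) = (\<Sum>\<^sub>\<infinity>j\<in>{k}. sin (sqrt (lam j) * t) / sqrt (lam j) *
        l2_inner (lebesgue_on D) w (\<phi> j) * l2_inner (lebesgue_on D) (\<phi> k) (\<phi> j))"
    unfolding wave_propagator_inner_def by (rule infsum_cong_neutral) (use k orth in auto)
  then show ?thesis
    using orth[OF k] by simp
qed

text \<open>The bound uses \<open>\<bar>K\<bar>\<close> because an almost everywhere bound on an
  empty interval may be negative.\<close>

lemma abs_integral_mode_le:
  fixes h :: "real \<Rightarrow> real" and w T K :: real
  assumes h: "h \<in> borel_measurable (lebesgue_on {0<..<T})" "AE \<tau> in lebesgue_on {0<..<T}. \<bar>h \<tau>\<bar> \<le> K"
    and T: "0 \<le> T" and w: "0 < w"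
  shows "\<bar>\<integral>\<tau>. h \<tau> * (sin (w * (T - \<tau>)) / w) \<partial>lebesgue_on {0<..<T}\<bar> \<le> \<bar>K\<bar> * T / w"
proof -
  let ?L = "lebesgue_on {0<..<T}"
  interpret finite_measure ?L
    by (rule finite_measureI) (subst emeasure_restrict_space; simp add: T)
  have le: "AE \<tau> in ?L. \<bar>h \<tau> * (sin (w * (T - \<tau>)) / w)\<bar> \<le> \<bar>K\<bar> / w"
    using h(2)
  proof eventually_elim
    case (elim \<tau>)
    then have "\<bar>h \<tau>\<bar> * \<bar>sin (w * (T - \<tau>))\<bar> \<le> \<bar>K\<bar> * 1"
      by (intro mult_mono) auto
    then show ?case
      using w by (simp add: abs_mult divide_right_mono)
  qed
  have "(\<lambda>\<tau>. sin (w * (T - \<tau>)) / w) \<in> borel_measurable ?L"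
    by (intro measurable_restrict_space1 measurable_completion) simp
  then have int: "integrable ?L (\<lambda>\<tau>. h \<tau> * (sin (w * (T - \<tau>)) / w))"
    using le h(1) by (intro integrable_const_bound[where B = "\<bar>K\<bar> / w"] borel_measurable_times) simp_all
  have "\<bar>\<integral>\<tau>. h \<tau> * (sin (w * (T - \<tau>)) / w) \<partial>?L\<bar> \<le> (\<integral>\<tau>. \<bar>h \<tau> * (sin (w * (T - \<tau>)) / w)\<bar> \<partial>?L)"
    by (rule integral_abs_bound)
  also have "\<dots> \<le> (\<integral>\<tau>. \<bar>K\<bar> / w \<partial>?L)"
    by (rule integral_mono_AE[OF integrable_abs[OF int] _ le]) simp
  also have "\<dots> = \<bar>K\<bar> * T / w"
    using T by (simp add: measure_restrict_space)
  finally show ?thesis .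
qed

section \<open>Mean, variance and decay of the modes\<close>

theorem theorem4p4:
  fixes T H :: real
    and D :: "'a::euclidean_space set"
    and f g :: "'a \<Rightarrow> real"
    and h :: "real \<Rightarrow> real"
    and lam :: "nat \<Rightarrow> real"
    and \<phi> :: "nat \<Rightarrow> 'a \<Rightarrow> real"
    and M :: "'w measure"
    and B :: "real \<Rightarrow> 'w \<Rightarrow> real"
    and u :: "real \<Rightarrow> 'w \<Rightarrow> 'a \<Rightarrow> real"
  assumes "T > 0"
    and "bounded_lipschitz_domain D"
    and "0 < H" and "H < 1"
    and "f \<in> L2 (lebesgue_on D)"
    and "compact (ess_support D f)" and "ess_support D f \<subseteq> D"
    and "g \<in> L2 (lebesgue_on D)"
    and "compact (ess_support D g)" and "ess_support D g \<subseteq> D"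
    and "l2_norm (lebesgue_on D) g \<noteq> 0"
    and "h \<in> Linfty (lebesgue_on {0<..<T})"
    and "AE \<tau> in lebesgue_on {0<..<T}. 0 \<le> h \<tau>"
    and "emeasure lebesgue (ess_support {0<..<T} h) > 0"
    and "dirichlet_eigensystem D lam \<phi>"
    and "prob_space M"
    and "fractional_brownian_motion M H B"
    and "mild_solution D lam \<phi> M B T f g h u"
  defines "data \<equiv> \<lambda>k \<omega>. l2_inner (lebesgue_on D) (u T \<omega>) (\<phi> k)"
    and "a \<equiv> \<lambda>k. \<integral>\<tau>. h \<tau> * (sin (sqrt (lam k) * (T - \<tau>)) / sqrt (lam k)) \<partial>lebesgue_on {0<..<T}"
    and "b \<equiv> \<lambda>k. \<integral>\<omega>. (wiener_integral M B T
                     (\<lambda>\<tau>. sin (sqrt (lam k) * (T - \<tau>)) / sqrt (lam k)) \<omega>)\<^sup>2 \<partial>M"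
  shows "(\<forall>k\<ge>1. (\<integral>\<omega>. data k \<omega> \<partial>M) = l2_inner (lebesgue_on D) f (\<phi> k) * a k) \<and>
         (\<forall>k\<ge>1. covariance M (data k) (data k) = (l2_inner (lebesgue_on D) g (\<phi> k))\<^sup>2 * b k) \<and>
         a \<longlonglongrightarrow> 0 \<and> b \<longlonglongrightarrow> 0 \<and>
         (\<exists>C>0. \<forall>k\<ge>1. \<bar>a k\<bar> \<le> C / sqrt (lam k) \<and>
                       b k \<le> C * lam k powr (- min (2 * H) 1))"
proof -
  interpret prob_space M by fact
  interpret fbm M H B
    by unfold_locales (use assms in auto)
  let ?L = "lebesgue_on D"
  have sys: "0 < lam 1" "\<And>k. 1 \<le> k \<Longrightarrow> lam 1 \<le> lam k" "filterlim lam at_top sequentially"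
    and onb: "orthonormal_basis_L2 ?L \<phi>"
    using \<open>dirichlet_eigensystem D lam \<phi>\<close> by (auto simp: dirichlet_eigensystem_def)
  have lam_pos: "0 < lam k" if "1 \<le> k" for k
    using sys(1) sys(2)[OF that] by linarith
  define \<psi> where "\<psi> k \<tau> = sin (sqrt (lam k) * (T - \<tau>)) / sqrt (lam k)" for k \<tau>
  define W where "W k = wiener_integral M B T (\<psi> k)" for k
  have a_eq: "a k = (\<integral>\<tau>. h \<tau> * \<psi> k \<tau> \<partial>lebesgue_on {0<..<T})" for k
    by (simp add: a_def \<psi>_def)
  have b_eq: "b k = (\<integral>\<omega>. (W k \<omega>)\<^sup>2 \<partial>M)" for k
    by (simp add: b_def W_def \<psi>_def[abs_def])
  have lip: "1-lipschitz_on {0..T} (\<psi> k)" if "1 \<le> k" for k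
    unfolding \<psi>_def[abs_def] using lam_pos[OF that] by (intro lipschitz_sin_mode) simp
  have W: "is_wiener_integral M B T (\<psi> k) (W k)" if "1 \<le> k" for k
    unfolding W_def using wiener_integral_exists[OF \<open>T > 0\<close> lip[OF that]] is_wiener_integral_some by metis
  then have W2: "W k \<in> L2 M" if "1 \<le> k" for k
    using that by (simp add: is_wiener_integral_def)
  \<comment> \<open>The mild solution at time \<open>T\<close> is tested against
    \<open>\<phi> k\<close>, which reduces both propagator terms to the mode
    \<open>\<psi> k\<close>.\<close>
  have data_meas: "data k \<in> borel_measurable M"
    and data_eq: "AE \<omega> in M. data k \<omega> = l2_inner ?L f (\<phi> k) * a k + l2_inner ?L g (\<phi> k) * W k \<omega>"
    if k: "1 \<le> k" for k
  proof -
    have \<phi>: "\<phi> k \<in> L2 ?L"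
      using onb k by (simp add: orthonormal_basis_L2_def)
    have modes: "(\<lambda>\<tau>. wave_propagator_inner D lam \<phi> (T - \<tau>) w (\<phi> k)) = (\<lambda>\<tau>. l2_inner ?L w (\<phi> k) * \<psi> k \<tau>)"
      for w
      by (simp add: wave_propagator_inner_eigenfunction[OF onb k] \<psi>_def)
    have "T \<in> {0..T}"
      using \<open>T > 0\<close> by simp
    then have mild: "data k \<in> borel_measurable M"
      "AE \<omega> in M. data k \<omega> =
        (\<integral>\<tau>. wave_propagator_inner D lam \<phi> (T - \<tau>) f (\<phi> k) * h \<tau> \<partial>lebesgue_on {0<..<T}) +
        wiener_integral M B T (\<lambda>\<tau>. wave_propagator_inner D lam \<phi> (T - \<tau>) g (\<phi> k)) \<omega>"
      using \<open>mild_solution D lam \<phi> M B T f g h u\<close> \<phi> unfolding mild_solution_def data_def by blast+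
    then show "data k \<in> borel_measurable M"
      by simp
    have "(\<integral>\<tau>. wave_propagator_inner D lam \<phi> (T - \<tau>) f (\<phi> k) * h \<tau> \<partial>lebesgue_on {0<..<T})
        = (\<integral>\<tau>. l2_inner ?L f (\<phi> k) * (h \<tau> * \<psi> k \<tau>) \<partial>lebesgue_on {0<..<T})"
      using fun_cong[OF modes[of f]] by (intro Bochner_Integration.integral_cong) (simp_all add: mult_ac)
    also have "\<dots> = l2_inner ?L f (\<phi> k) * a k"
      by (simp add: a_eq)
    finally have "(\<integral>\<tau>. wave_propagator_inner D lam \<phi> (T - \<tau>) f (\<phi> k) * h \<tau> \<partial>lebesgue_on {0<..<T})
        = l2_inner ?L f (\<phi> k) * a k" .
    \<comment> \<open>\<open>wiener_integral\<close> is a choice of version, so the constant can be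
      pulled out only almost surely, by comparing two versions of the same integral.\<close>
    moreover have "AE \<omega> in M. wiener_integral M B T (\<lambda>\<tau>. l2_inner ?L g (\<phi> k) * \<psi> k \<tau>) \<omega>
        = l2_inner ?L g (\<phi> k) * W k \<omega>"
      by (rule wiener_integral_unique[OF is_wiener_integral_some]; rule is_wiener_integral_cmult[OF W[OF k]])
    ultimately show "AE \<omega> in M. data k \<omega> = l2_inner ?L f (\<phi> k) * a k + l2_inner ?L g (\<phi> k) * W k \<omega>"
      using mild(2) unfolding modes by auto
  qed
  have mean: "(\<integral>\<omega>. data k \<omega> \<partial>M) = l2_inner ?L f (\<phi> k) * a k" if k: "1 \<le> k" for k
  proof -
    have "integrable M (W k)"
      using L2_mult_integrable[OF W2[OF k] const_L2[of 1]] by simp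
    moreover have "(\<integral>\<omega>. data k \<omega> \<partial>M) = (\<integral>\<omega>. l2_inner ?L f (\<phi> k) * a k + l2_inner ?L g (\<phi> k) * W k \<omega> \<partial>M)"
      using data_eq[OF k] data_meas[OF k] W2[OF k] by (intro integral_cong_AE) auto
    ultimately show ?thesis
      using mean_wiener_integral[OF W[OF k]] by (simp add: prob_space)
  qed
  have cov: "covariance M (data k) (data k) = (l2_inner ?L g (\<phi> k))\<^sup>2 * b k" if k: "1 \<le> k" for k
  proof -
    have "covariance M (data k) (data k) = (\<integral>\<omega>. (l2_inner ?L g (\<phi> k))\<^sup>2 * (W k \<omega>)\<^sup>2 \<partial>M)"
      unfolding covariance_def mean[OF k]
    proof (rule integral_cong_AE)
      show "AE \<omega> in M. (data k \<omega> - l2_inner ?L f (\<phi> k) * a k) * (data k \<omega> - l2_inner ?L f (\<phi> k) * a k)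
          = (l2_inner ?L g (\<phi> k))\<^sup>2 * (W k \<omega>)\<^sup>2"
        using data_eq[OF k] by eventually_elim (simp add: power2_eq_square)
    qed (use data_meas[OF k] W2[OF k] in auto)
    then show ?thesis
      by (simp add: b_eq)
  qed
  obtain K where K: "AE \<tau> in lebesgue_on {0<..<T}. \<bar>h \<tau>\<bar> \<le> K" and h: "h \<in> borel_measurable (lebesgue_on {0<..<T})"
    using \<open>h \<in> Linfty (lebesgue_on {0<..<T})\<close> by (auto simp: Linfty_def)
  have a_le: "\<bar>a k\<bar> \<le> \<bar>K\<bar> * T / sqrt (lam k)" if "1 \<le> k" for k
    unfolding a_def using abs_integral_mode_le[OF h K] lam_pos[OF that] \<open>T > 0\<close> by simp
  define \<gamma> where "\<gamma> = min (2 * H) 1"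
  have \<gamma>: "0 < \<gamma>"
    using \<open>0 < H\<close> by (simp add: \<gamma>_def)
  \<comment> \<open>The first term decays like the inverse of \<open>lam k\<close>. Since
    \<open>\<gamma> \<le> 1\<close>, the excess factor \<open>lam k powr (\<gamma> - 1)\<close> is
    at most its value at the smallest eigenvalue.\<close>
  define C1 where "C1 = T powr (2 * H) * lam 1 powr (\<gamma> - 1)"
  \<comment> \<open>The interpolation term with \<open>A = 1 / sqrt (lam k)\<close> and
    \<open>L = 1\<close>: its power \<open>4 * H\<close> of \<open>2 * A\<close> supplies
    \<open>lam k powr - (2 * H)\<close>, and \<open>\<gamma> = 2 * H\<close> when
    \<open>H < 1/2\<close>.\<close>
  define C2 where "C2 = (if H < 1 / 2 then 2 powr (4 * H) * T powr (2 - 2 * H) / (1 - 2 * H) else 0)"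
  have C12: "0 \<le> C1" "0 \<le> C2"
    by (auto simp: C1_def C2_def)
  have b_le: "b k \<le> (C1 + C2) * lam k powr - \<gamma>" if k: "1 \<le> k" for k
  proof -
    have pos: "0 < lam k"
      using lam_pos[OF k] .
    have "\<bar>\<psi> k \<tau>\<bar> \<le> 1 / sqrt (lam k)" for \<tau>
      using pos by (simp add: \<psi>_def divide_right_mono)
    then have "b k \<le> (1 / sqrt (lam k))\<^sup>2 * T powr (2 * H) +
        (if H < 1 / 2 then (2 * (1 / sqrt (lam k))) powr (4 * H) * 1 powr (2 - 4 * H) * T powr (2 - 2 * H) / (1 - 2 * H) else 0)"
      unfolding b_eq by (intro wiener_integral_second_moment[OF \<open>T > 0\<close> lip[OF k] _ W[OF k]])
    also have "(1 / sqrt (lam k))\<^sup>2 * T powr (2 * H) \<le> C1 * lam k powr - \<gamma>"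
    proof -
      have "(1 / sqrt (lam k))\<^sup>2 = lam k powr - 1"
        using pos by (simp add: power_divide powr_minus_divide)
      also have "\<dots> = lam k powr (\<gamma> - 1) * lam k powr - \<gamma>"
        by (simp flip: powr_add)
      also have "\<dots> \<le> lam 1 powr (\<gamma> - 1) * lam k powr - \<gamma>"
        using sys(1) sys(2)[OF k] by (intro mult_right_mono powr_mono2') (auto simp: \<gamma>_def)
      finally have "(1 / sqrt (lam k))\<^sup>2 * T powr (2 * H)
          \<le> lam 1 powr (\<gamma> - 1) * lam k powr - \<gamma> * T powr (2 * H)"
        by (rule mult_right_mono) simp
      then show ?thesis
        by (simp only: C1_def mult_ac)
    qed
    also have "(if H < 1 / 2 then (2 * (1 / sqrt (lam k))) powr (4 * H) * 1 powr (2 - 4 * H) * T powr (2 - 2 * H) / (1 - 2 * H) else 0)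
        = C2 * lam k powr - \<gamma>"
    proof -
      have "(2 * (1 / sqrt (lam k))) powr (4 * H) = 2 powr (4 * H) * lam k powr - (2 * H)"
      proof -
        have "(1 / sqrt (lam k)) = lam k powr - (1 / 2)"
          using pos by (simp add: powr_minus_divide powr_half_sqrt)
        then show ?thesis
          using pos by (simp add: powr_mult powr_powr)
      qed
      then show ?thesis
        by (simp add: C2_def \<gamma>_def min_def)
    qed
    finally show ?thesis
      by (simp add: distrib_right)
  qed
  \<comment> \<open>The summand 1 gives positivity directly from the nonnegativity of the
    others.\<close>
  define C where "C = \<bar>K\<bar> * T + C1 + C2 + 1"
  have C: "0 < C"
    using C12 \<open>T > 0\<close> by (simp add: C_def add_nonneg_pos)
  have a_C: "\<bar>a k\<bar> \<le> C / sqrt (lam k)" if "1 \<le> k" for k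
    using a_le[OF that] C12 lam_pos[OF that]
    by (elim order_trans) (auto simp: C_def intro!: divide_right_mono)
  have b_C: "b k \<le> C * lam k powr - \<gamma>" if "1 \<le> k" for k
    using b_le[OF that] C12 \<open>T > 0\<close> by (elim order_trans) (auto simp: C_def intro!: mult_right_mono)
  have "a \<longlonglongrightarrow> 0"
  proof (rule Lim_null_comparison)
    \<comment> \<open>The bound is available from index 1 on, which is enough for an eventual
      estimate.\<close>
    show "\<forall>\<^sub>F k in sequentially. norm (a k) \<le> C / sqrt (lam k)"
      using a_C by (auto simp: eventually_sequentially intro!: exI[of _ 1])
    show "(\<lambda>k. C / sqrt (lam k)) \<longlonglongrightarrow> 0"
      by (intro real_tendsto_divide_at_top[OF tendsto_const] filterlim_compose[OF sqrt_at_top sys(3)])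
  qed
  moreover have "b \<longlonglongrightarrow> 0"
  proof (rule Lim_null_comparison)
    have "0 \<le> b k" for k
      by (simp add: b_eq)
    then show "\<forall>\<^sub>F k in sequentially. norm (b k) \<le> C * lam k powr - \<gamma>"
      using b_C by (auto simp: eventually_sequentially intro!: exI[of _ 1])
    show "(\<lambda>k. C * lam k powr - \<gamma>) \<longlonglongrightarrow> 0"
      using \<gamma> by (intro tendsto_mult_right_zero tendsto_neg_powr sys(3)) simp
  qed
  ultimately show ?thesis
    using mean cov a_C b_C C unfolding \<gamma>_def by blast
qed

end
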